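(* Let $d\ge1$ and $X\subseteq\mathbb{T}_{\pm}^d$. Then $$\mathrm{conv}_{TC}(X)=\bigcup\Bigl\{\mathrm{Faces}(X\odot\mathrm{diag}(\lambda)):\ \lambda\in\mathbb{T}_{\ge\mathbb{O}}^X,\ \bigoplus_{x\in X}\lambda_x=0,\ |\mathrm{supp}(\lambda)|\le c_d\Bigr\},$$ where $c_d=d2^d+1$.
   Context: Signed tropical numbers. Let $\mathbb{O}=-\infty$ be the tropical zero. $\mathbb{T}_{>\mathbb{O}}=\mathbb{R}$ (positive numbers), $\mathbb{T}_{<\mathbb{O}}=\{\ominus r: r\in\mathbb{R}\}$ (negative numbers), $\mathbb{T}_{\ge\mathbb{O}}=\mathbb{R}\cup\{\mathbb{O}\}$, $\mathbb{T}_{\pm}=\mathbb{T}_{>\mathbb{O}}\cup\mathbb{T}_{<\mathbb{O}}\cup\{\mathbb{O}\}$, balanced numbers $\mathbb{T}_{\bullet}=\{\bullet r: r\in\mathbb{R}\}\cup\{\mathbb{O}\}$, symmetrized semiring $\mathbb{S}=\mathbb{T}_{\pm}\cup\mathbb{T}_{\bullet}$. The norm is $|r|=|\ominus r|=|\bullet r|=r$ and $|\mathbb{O}|=\mathbb{O}$; the sign $\mathrm{tsgn}$ takes values in $\{\oplus,\ominus,\bullet,\mathbb{O}\}$. Addition on $\mathbb{S}$: $x\oplus y$ equals $x$ if $|x|>|y|$, $y$ if $|y|>|x|$, $x$ if $|x|=|y|$ and $\mathrm{tsgn}(x)=\mathrm{tsgn}(y)$, and $\bullet|x|$ if $|x|=|y|$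 and the signs differ. Multiplication: $x\odot y$ has norm $|x|+|y|$ and sign the product of signs (with $\oplus,\ominus,\bullet$ multiplying like $1,-1,0$); $\mathbb{O}$ is absorbing. The multiplicative unit is the real number $0$. Operations extend to vectors in the usual way. Order on $\mathbb{T}_{\pm}$: $x>y$ iff $x\oplus(\ominus y)\in\mathbb{T}_{>\mathbb{O}}$ (a total order). Left sum: $x\lhd y=x$ if $|x|=|y|$ and $x\lhd y=x\oplus y$ otherwise; componentwise on vectors; it is associative on $\mathbb{T}_{\pm}^d$. TC-convexity. For $a=(a_0,\dots,a_d)\in\mathbb{T}_{\pm}^{d+1}$ with $(a_1,\dots,a_d)\ne(\mathbb{O},\dots,\mathbb{O})$, the closed halfspace is $\overline{\mathcal{H}}^+(a)=\{x\in\mathbb{T}_{\pm}^d: a_0\oplus a_1\odot x_1\oplus\dots\oplus a_d\odot x_d\in\mathbb{T}_{>\mathbb{O}}\cup\mathbb{T}_{\bullet}\}$. For two points, $\mathrm{conv}_{TC}(x,y)$ is the intersection of all closed halfspaces containing both. A set $S$ is TC-convex if $\mathrm{conv}_{TC}(x,y)\subseteq S$ for all $x,y\in S$. $\mathrm{conv}_{TC}(M)$ is the intersection of all TC-convex sets containing $M$. Faces operator. For $s\in\mathbb{S}$, $\mathcal{U}(s)=\{x\in\mathbb{T}_{\pm}:\ominus|s|\le x\le|s|\}$ if $s\in\mathbb{T}_{\bullet}$ and $\mathcal{U}(s)=\{s\}$ otherwise; for vectors $\mathcal{U}(s)=\prod_i\mathcal{U}(s_i)$, viewed as an axis-parallel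 hypercube. $\mathcal{U}(s')$ is a face of $\mathcal{U}(s)$ if $s'_k=s_k$ whenever $s_k\in\mathbb{T}_{\pm}$ and $|s'_k|=|s_k|$ for every other $k$; a face is a vertex if $s'\in\mathbb{T}_{\pm}^d$ (then $\mathcal U(s')=\{s'\}$). For $x_1,\dots,x_n\in\mathbb{T}_{\pm}^d$, $\mathrm{Vert}(x_1,\dots,x_n)=\{x_{\sigma(1)}\lhd\dots\lhd x_{\sigma(n)}:\sigma\in\mathrm{Sym}(n)\}$, a subset of the vertices of $\mathcal{U}(x_1\oplus\dots\oplus x_n)$, and $\mathrm{Faces}(x_1,\dots,x_n)$ is the union of all faces of $\mathcal{U}(x_1\oplus\dots\oplus x_n)$ all of whose vertices belong to $\mathrm{Vert}(x_1,\dots,x_n)$. For $\lambda\in\mathbb{T}_{\ge\mathbb{O}}^X$ (a function $X\to\mathbb{T}_{\ge\mathbb{O}}$) with finite support $\mathrm{supp}(\lambda)=\{x\in X:\lambda_x\ne\mathbb{O}\}$, $X\odot\mathrm{diag}(\lambda)$ denotes the finite family of points $\lambda_x\odot x$, $x\in\mathrm{supp}(\lambda)$. *)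

theory Defs
  imports "HOL-Analysis.Analysis" "HOL-Combinatorics.Multiset_Permutations"
begin

datatype tsgn = Pos | Neg | Bal

text \<open>The symmetrized semiring: \<open>TNum Pos r\<close> is the positive number \<open>r\<close>,
  \<open>TNum Neg r\<close> is \<open>\<ominus>r\<close>, \<open>TNum Bal r\<close> is \<open>\<bullet>r\<close>, and \<open>TInf\<close> is the tropical zero,
  i.e. minus infinity.\<close>

datatype symtrop = TInf | TNum tsgn real

fun tsgn_mult :: "tsgn \<Rightarrow> tsgn \<Rightarrow> tsgn" where
  "tsgn_mult Pos t = t"
| "tsgn_mult Neg Pos = Neg"
| "tsgn_mult Neg Neg = Pos"
| "tsgn_mult Neg Bal = Bal"
| "tsgn_mult Bal t = Bal"

definition T_pos :: "symtrop set" where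
  "T_pos = range (TNum Pos)"

definition T_neg :: "symtrop set" where
  "T_neg = range (TNum Neg)"

definition T_nonneg :: "symtrop set" where
  "T_nonneg = insert TInf T_pos"

definition T_signed :: "symtrop set" where
  "T_signed = T_pos \<union> T_neg \<union> {TInf}"

definition T_bal :: "symtrop set" where
  "T_bal = insert TInf (range (TNum Bal))"

text \<open>The class constants carry the tropical operations: \<open>+\<close> is \<open>\<oplus>\<close>, \<open>*\<close> is \<open>\<odot>\<close>, \<open>-x\<close> is
  \<open>\<ominus>x\<close>. Pitfall: the constant \<open>0\<close> of type \<^typ>\<open>symtrop\<close> is minus infinity, while \<open>1\<close> is the
  real number zero. The norm \<open>\<bar>x\<bar>\<close> takes its values in \<^const>\<open>T_nonneg\<close>.\<close>

instantiation symtrop :: "{zero, one, plus, times, uminus, abs}"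
begin

definition "0 = TInf"

definition "1 = TNum Pos 0"

fun plus_symtrop :: "symtrop \<Rightarrow> symtrop \<Rightarrow> symtrop" where
  "plus_symtrop TInf y = y"
| "plus_symtrop x TInf = x"
| "plus_symtrop (TNum s a) (TNum t b) =
     (if a > b then TNum s a
      else if b > a then TNum t b
      else if s = t then TNum s a
      else TNum Bal a)"

fun times_symtrop :: "symtrop \<Rightarrow> symtrop \<Rightarrow> symtrop" where
  "times_symtrop TInf y = TInf"
| "times_symtrop x TInf = TInf"
| "times_symtrop (TNum s a) (TNum t b) = TNum (tsgn_mult s t) (a + b)"

fun uminus_symtrop :: "symtrop \<Rightarrow> symtrop" where
  "uminus_symtrop TInf = TInf"
| "uminus_symtrop (TNum s a) = TNum (tsgn_mult Neg s) a"

fun abs_symtrop :: "symtrop \<Rightarrow> symtrop" where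
  "abs_symtrop TInf = TInf"
| "abs_symtrop (TNum s a) = TNum Pos a"

instance ..

end

instance symtrop :: comm_semiring_1
proof
  fix x y z :: symtrop
  show "x + y + z = x + (y + z)"
    by (cases x; cases y; cases z) auto
  show "x + y = y + x"
    by (cases x; cases y) auto
  show "0 + x = x"
    by (simp add: zero_symtrop_def)
  have sgn_assoc: "tsgn_mult (tsgn_mult r s) t = tsgn_mult r (tsgn_mult s t)" for r s t
    by (cases r; cases s; cases t) auto
  have sgn_comm: "tsgn_mult r s = tsgn_mult s r" for r s
    by (cases r; cases s) auto
  show "x * y * z = x * (y * z)"
    by (cases x; cases y; cases z) (auto simp: sgn_assoc)
  show "x * y = y * x"
    by (cases x; cases y) (auto simp: sgn_comm)
  show "1 * x = x"
    by (cases x) (auto simp: one_symtrop_def)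
  have sgn_inj: "tsgn_mult s t = Bal" if "tsgn_mult r t = tsgn_mult s t" "r \<noteq> s" for r s t
    using that by (cases r; cases s; cases t) auto
  show "(x + y) * z = x * z + y * z"
    by (cases x; cases y; cases z) (auto dest:  sgn_inj)
  show "0 * x = 0" and "x * 0 = 0"
    by (cases x; simp add: zero_symtrop_def)+
  show "(0::symtrop) \<noteq> 1"
    by (simp add: zero_symtrop_def one_symtrop_def)
qed

text \<open>The order is only meant to be used on \<^const>\<open>T_signed\<close>, where it is total; balanced numbers
  are outside its intended domain.\<close>

instantiation symtrop :: ord
begin

definition less_symtrop :: "symtrop \<Rightarrow> symtrop \<Rightarrow> bool" where
  "x < y \<longleftrightarrow> y + (- x) \<in> T_pos"

definition less_eq_symtrop :: "symtrop \<Rightarrow> symtrop \<Rightarrow> bool" where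
  "x \<le> y \<longleftrightarrow> x < y \<or> x = (y::symtrop)"

instance ..

end

definition left_sum :: "symtrop \<Rightarrow> symtrop \<Rightarrow> symtrop" where
  "left_sum x y = (if \<bar>x\<bar> = \<bar>y\<bar> then x else x + y)"

definition left_sum_vec :: "symtrop ^ 'n \<Rightarrow> symtrop ^ 'n \<Rightarrow> symtrop ^ 'n" where
  "left_sum_vec x y = (\<chi> i. left_sum (x $ i) (y $ i))"

definition signed_vecs :: "(symtrop ^ 'n) set" where
  "signed_vecs = {x. \<forall>i. x $ i \<in> T_signed}"

text \<open>The coefficient vector is split into its constant term \<open>a0\<close> and its linear part \<open>a\<close>.\<close>

definition closed_halfspace :: "symtrop \<Rightarrow> symtrop ^ 'n::finite \<Rightarrow> (symtrop ^ 'n) set" where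
  "closed_halfspace a0 a =
     {x \<in> signed_vecs. a0 + (\<Sum>i\<in>UNIV. a $ i * x $ i) \<in> T_pos \<union> T_bal}"

definition closed_halfspaces :: "(symtrop ^ 'n::finite) set set" where
  "closed_halfspaces =
     {closed_halfspace a0 a | a0 a. a0 \<in> T_signed \<and> a \<in> signed_vecs \<and> a \<noteq> 0}"

definition conv_TC2 :: "symtrop ^ 'n::finite \<Rightarrow> symtrop ^ 'n \<Rightarrow> (symtrop ^ 'n) set" where
  "conv_TC2 x y = {z \<in> signed_vecs. \<forall>H\<in>closed_halfspaces. x \<in> H \<and> y \<in> H \<longrightarrow> z \<in> H}"

definition TC_convex :: "(symtrop ^ 'n::finite) set \<Rightarrow> bool" where
  "TC_convex S \<longleftrightarrow> S \<subseteq> signed_vecs \<and> (\<forall>x\<in>S. \<forall>y\<in>S. conv_TC2 x y \<subseteq> S)"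

definition conv_TC :: "(symtrop ^ 'n::finite) set \<Rightarrow> (symtrop ^ 'n) set" where
  "conv_TC M = TC_convex hull M"

definition U_set :: "symtrop \<Rightarrow> symtrop set" where
  "U_set s = (if s \<in> T_bal then {x \<in> T_signed. - \<bar>s\<bar> \<le> x \<and> x \<le> \<bar>s\<bar>} else {s})"

definition U_cube :: "symtrop ^ 'n \<Rightarrow> (symtrop ^ 'n) set" where
  "U_cube s = {x. \<forall>i. x $ i \<in> U_set (s $ i)}"

text \<open>\<open>is_face s' s\<close> says that \<open>U_cube s'\<close> is a face of \<open>U_cube s\<close>; vectors in \<^const>\<open>signed_vecs\<close>
  encode the vertices.\<close>

definition is_face :: "symtrop ^ 'n \<Rightarrow> symtrop ^ 'n \<Rightarrow> bool" where
  "is_face s' s \<longleftrightarrow>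
     (\<forall>k. if s $ k \<in> T_signed then s' $ k = s $ k else \<bar>s' $ k\<bar> = \<bar>s $ k\<bar>)"

text \<open>A finite family of points is given by a finite index set \<open>I\<close> and a function \<open>p\<close>, so that
  repeated points are allowed. The permutations of the family are the enumerations of \<open>I\<close>.
  The base value \<open>0\<close> of the fold is neutral for the left sum, hence contributes nothing.\<close>

definition Vert :: "'i set \<Rightarrow> ('i \<Rightarrow> symtrop ^ 'n) \<Rightarrow> (symtrop ^ 'n) set" where
  "Vert I p = {foldl left_sum_vec 0 (map p js) | js. js \<in> permutations_of_set I}"

definition Faces :: "'i set \<Rightarrow> ('i \<Rightarrow> symtrop ^ 'n) \<Rightarrow> (symtrop ^ 'n) set" where
  "Faces I p =
     \<Union> {U_cube s' | s'. is_face s' (\<Sum>i\<in>I. p i) \<and>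
          (\<forall>v\<in>signed_vecs. is_face v s' \<longrightarrow> v \<in> Vert I p)}"

definition tsupp :: "'i set \<Rightarrow> ('i \<Rightarrow> symtrop) \<Rightarrow> 'i set" where
  "tsupp X l = {x \<in> X. l x \<noteq> 0}"

text \<open>The family of points \<open>l x \<odot> x\<close>, \<open>x\<close> in the support of \<open>l\<close>, enters through its \<open>Faces\<close>.\<close>

definition Faces_diag :: "(symtrop ^ 'n) set \<Rightarrow> (symtrop ^ 'n \<Rightarrow> symtrop) \<Rightarrow> (symtrop ^ 'n) set" where
  "Faces_diag X l = Faces (tsupp X l) (\<lambda>x. l x *s x)"

end

theory Submission
  imports Defs
begin

text \<open>
  Every point of a face of \<open>U(x\<^sub>1 \<oplus> \<dots> \<oplus> x\<^sub>n)\<close> lies in a smallest face, and a vertex of that face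
  belongs to \<open>Vert\<close> iff the points can be ranked such that in each coordinate the first entries of
  maximal norm agree with the vertex. A TC-convex set contains these vertices because left sums of two
  points lie in their TC-segment, and then it contains the face by filling one coordinate at a time.

  Conversely, a point of the TC-segment of \<open>u\<close> and \<open>v\<close> is a left sum of multiples of \<open>u\<close> and \<open>v\<close>, up
  to filling in one coordinate: along the path of left sums from \<open>v\<close> to \<open>u\<close> every coordinate is
  monotone, so by Helly's theorem in dimension one only pairs of coordinates matter, and for these a
  separating halfspace can be written down. Left sums of points from two unions of faces are handled by
  concatenating the rankings, hence the union of all \<open>Faces\<close> is TC-convex. The bound on the support
  holds since each of the at most \<open>2\<^sup>d\<close> vertices of the smallest face needs only \<open>d\<close> of the points.
\<close>

section \<open>Norms and signed sums\<close>


text \<open>The obstacle throughout is that the left sum is not commutative: when two entries tie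
  with opposite signs, the order decides the sign, and different vertices of one face may need
  different orders. Each vertex therefore carries its own ranking, and two families are merged
  vertex by vertex. After suitable sign flips, a tie is also the only place where a coordinate of
  the path skips values, passing from \<ominus>r to r. If one coordinate of a point of the segment
  falls into such a jump, the halfspaces that pair it with any other coordinate pin that other
  coordinate to its value at the jump, for both orders of the left sum. This is why at most one
  coordinate needs filling. The bound on the support is imposed after the union without it is known
  to be TC-convex, since merging two combinations enlarges supports.\<close>

definition nrm :: "symtrop \<Rightarrow> real" where
  "nrm x = (case x of TInf \<Rightarrow> 0 | TNum s a \<Rightarrow> exp a)"

lemma nrm_simps [simp]: "nrm TInf = 0" "nrm (TNum s a) = exp a"
  by (simp_all add: nrm_def)

lemma nrm_nonneg [simp]: "0 \<le> nrm x"
  by (cases x) auto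

lemma nrm_zero [simp]: "nrm 0 = 0" and nrm_one [simp]: "nrm 1 = 1"
  by (simp_all add: zero_symtrop_def one_symtrop_def)

lemma nrm_eq_0_iff [simp]: "nrm x = 0 \<longleftrightarrow> x = 0"
  by (cases x) (auto simp: zero_symtrop_def)

lemma nrm_pos_iff [simp]: "0 < nrm x \<longleftrightarrow> x \<noteq> 0"
  by (cases x) (auto simp: zero_symtrop_def)

text \<open>The exponential in \<open>nrm\<close> serves this rule: norms multiply as reals and the
  tropical zero has norm 0, so comparisons of norms are real inequalities without a special case for
  minus infinity.\<close>

lemma nrm_mult [simp]: "nrm (x * y) = nrm x * nrm y"
  by (cases x; cases y) (auto simp: exp_add)

lemma nrm_uminus [simp]: "nrm (- x) = nrm x"
  by (cases x) auto

lemma nrm_plus: "nrm (x + y) = max (nrm x) (nrm y)"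
  by (cases x; cases y) auto

lemma abs_eq_iff_nrm: "\<bar>x\<bar> = \<bar>y\<bar> \<longleftrightarrow> nrm x = nrm (y :: symtrop)"
  by (cases x; cases y) (auto simp: less_imp_neq[OF exp_gt_zero])

lemma left_sum_nrm: "left_sum x y = (if nrm x < nrm y then y else x)"
  unfolding left_sum_def abs_eq_iff_nrm by (cases x; cases y) auto

lemma T_signed_iff: "x \<in> T_signed \<longleftrightarrow> x = TInf \<or> (\<exists>a. x = TNum Pos a) \<or> (\<exists>a. x = TNum Neg a)"
  by (auto simp: T_signed_def T_pos_def T_neg_def)

lemma T_nonneg_iff: "x \<in> T_nonneg \<longleftrightarrow> x = TInf \<or> (\<exists>a. x = TNum Pos a)"
  by (auto simp: T_nonneg_def T_pos_def)

lemma T_neg_iff: "x \<in> T_neg \<longleftrightarrow> (\<exists>a. x = TNum Neg a)"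
  by (auto simp: T_neg_def)

lemma T_pos_iff: "x \<in> T_pos \<longleftrightarrow> (\<exists>a. x = TNum Pos a)"
  by (auto simp: T_pos_def)

lemma T_bal_iff: "x \<in> T_bal \<longleftrightarrow> x = TInf \<or> (\<exists>a. x = TNum Bal a)"
  by (auto simp: T_bal_def)

lemmas T_iffs = T_signed_iff T_nonneg_iff T_neg_iff T_pos_iff T_bal_iff

text \<open>Since \<open>T_bal\<close> contains the tropical zero, only the negative numbers are
  left out. A point thus leaves a closed halfspace exactly when the affine form becomes negative,
  and halfspace arguments track negativity only.\<close>

lemma pos_or_bal_iff: "x \<in> T_pos \<union> T_bal \<longleftrightarrow> x \<notin> T_neg"
proof (cases x)
  case (TNum s a)
  then show ?thesis by (cases s) (auto simp: T_iffs)
qed (auto simp: T_iffs)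

lemma T_signed_cases [consumes 1, case_names Inf Pos Neg]:
  assumes "x \<in> T_signed"
  obtains "x = TInf" | a where "x = TNum Pos a" | a where "x = TNum Neg a"
  using assms by (auto simp: T_signed_iff)

lemma T_nonneg_cases [consumes 1, case_names Inf Pos]:
  assumes "x \<in> T_nonneg"
  obtains "x = TInf" | a where "x = TNum Pos a"
  using assms by (auto simp: T_nonneg_iff)

lemma T_nonneg_subset: "x \<in> T_nonneg \<Longrightarrow> x \<in> T_signed"
  by (auto simp: T_iffs)

lemma signed_simps [simp]: "0 \<in> T_signed" "1 \<in> T_signed" "0 \<in> T_nonneg" "1 \<in> T_nonneg"
  by (auto simp: T_iffs zero_symtrop_def one_symtrop_def)

lemma signed_mult [intro]: "x \<in> T_signed \<Longrightarrow> y \<in> T_signed \<Longrightarrow> x * y \<in> T_signed"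
  by (auto simp: T_signed_iff)

lemma signed_uminus [simp]: "- x \<in> T_signed \<longleftrightarrow> x \<in> T_signed"
proof (cases x)
  case (TNum s a)
  then show ?thesis by (cases s) (auto simp: T_signed_iff)
qed (auto simp: T_signed_iff)

lemma signed_left_sum [intro]: "x \<in> T_signed \<Longrightarrow> y \<in> T_signed \<Longrightarrow> left_sum x y \<in> T_signed"
  by (auto simp: left_sum_nrm)

lemma nonneg_mult [intro]: "x \<in> T_nonneg \<Longrightarrow> y \<in> T_nonneg \<Longrightarrow> x * y \<in> T_nonneg"
  by (auto simp: T_nonneg_iff)

lemma nonneg_plus [intro]: "x \<in> T_nonneg \<Longrightarrow> y \<in> T_nonneg \<Longrightarrow> x + y \<in> T_nonneg"
  by (erule T_nonneg_cases; erule T_nonneg_cases) (auto simp: T_nonneg_iff)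

lemma nonneg_eqI: "x \<in> T_nonneg \<Longrightarrow> y \<in> T_nonneg \<Longrightarrow> nrm x = nrm y \<Longrightarrow> x = y"
  by (auto simp: T_nonneg_iff less_imp_neq[OF exp_gt_zero])

lemma nonneg_plus_left: "x \<in> T_nonneg \<Longrightarrow> y \<in> T_nonneg \<Longrightarrow> nrm y \<le> nrm x \<Longrightarrow> x + y = x"
  by (rule nonneg_eqI) (auto simp: nrm_plus)

lemma signed_eq_or_uminus:
  "x \<in> T_signed \<Longrightarrow> y \<in> T_signed \<Longrightarrow> nrm x = nrm y \<Longrightarrow> x = y \<or> x = - y"
  by (auto simp: T_signed_iff less_imp_neq[OF exp_gt_zero])

text \<open>A balanced factor would forget signs; a nonzero signed factor only shifts the norm and
  possibly swaps signs, so it cancels.\<close>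

lemma mult_inj_symtrop:
  fixes c x y :: symtrop
  assumes "c \<in> T_signed" "c \<noteq> 0" "c * x = c * y" shows "x = y"
proof -
  have "tsgn_mult Neg s = tsgn_mult Neg t \<Longrightarrow> s = t" for s t by (cases s; cases t) auto
  with assms show ?thesis
    by (cases x; cases y) (auto simp: T_signed_iff zero_symtrop_def)
qed

lemma uminus_mult_symtrop: "- (x :: symtrop) = TNum Neg 0 * x"
  by (cases x) auto

lemma left_sum_mult: "c * left_sum x y = left_sum (c * x) (c * y)"
  by (cases "c = 0") (auto simp: left_sum_nrm)

lemma sum_nrm_le: "finite I \<Longrightarrow> i \<in> I \<Longrightarrow> nrm (f i) \<le> nrm (\<Sum>i\<in>I. f i)"
  by (induction I rule: finite_induct) (auto simp: nrm_plus)

lemma sum_nrm_attained: "finite I \<Longrightarrow> (\<Sum>i\<in>I. f i) \<noteq> 0 \<Longrightarrow> \<exists>i\<in>I. nrm (f i) = nrm (\<Sum>i\<in>I. f i)"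
proof (induction I rule: finite_induct)
  case (insert i I)
  show ?case
  proof (cases "nrm (\<Sum>i\<in>I. f i) \<le> nrm (f i)")
    case True
    then show ?thesis using insert by (auto simp: nrm_plus)
  next
    case False
    then have "(\<Sum>i\<in>I. f i) \<noteq> 0" by (metis nrm_nonneg nrm_zero)
    then show ?thesis using insert False by (auto simp: nrm_plus)
  qed
qed auto

text \<open>Two different terms of maximal norm would make the sum balanced, so in a signed sum
  every term of maximal norm is the sum itself.\<close>

lemma sum_signed_term:
  assumes "finite I" "i \<in> I" "\<And>i. i \<in> I \<Longrightarrow> f i \<in> T_signed" "(\<Sum>i\<in>I. f i) \<in> T_signed"
    and "nrm (f i) = nrm (\<Sum>i\<in>I. f i)"
  shows "f i = (\<Sum>i\<in>I. f i)"
proof -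
  have eq: "(\<Sum>i\<in>I. f i) = f i + (\<Sum>i\<in>I - {i}. f i)" using assms(1,2) by (rule sum.remove)
  have "x = x + y" if "x \<in> T_signed" "x + y \<in> T_signed" "nrm x = nrm (x + y)" for x y
    using that by (cases y) (auto simp: T_signed_iff split: if_splits)
  then show ?thesis using assms eq by metis
qed

text \<open>Only the terms of maximal norm decide a tropical sum, and one of them that is not
  negative turns the sum positive or balanced.\<close>

lemma sum_neg_iff:
  assumes "finite I"
  shows "(\<Sum>i\<in>I. f i) \<in> T_neg \<longleftrightarrow>
    (\<exists>i\<in>I. f i \<in> T_neg \<and> (\<forall>j\<in>I. nrm (f j) \<le> nrm (f i) \<and> (nrm (f j) = nrm (f i) \<longrightarrow> f j \<in> T_neg)))"
  using assms
proof (induction I rule: finite_induct)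
  case empty
  then show ?case by (auto simp: T_neg_iff zero_symtrop_def)
next
  case (insert a I)
  have neg_plus: "x + y \<in> T_neg \<longleftrightarrow>
      x \<in> T_neg \<and> (nrm y \<le> nrm x \<and> (nrm y = nrm x \<longrightarrow> y \<in> T_neg)) \<or>
      y \<in> T_neg \<and> (nrm x \<le> nrm y \<and> (nrm x = nrm y \<longrightarrow> x \<in> T_neg))" for x y
    by (cases x; cases y) (auto simp: T_neg_iff)
  let ?s = "\<Sum>i\<in>I. f i"
  have le: "nrm (f j) \<le> nrm ?s" if "j \<in> I" for j using insert(1) that by (rule sum_nrm_le)
  show ?case (is "?L \<longleftrightarrow> ?R")
  proof
    assume ?L
    then have "f a + ?s \<in> T_neg" using insert by simp
    then consider "f a \<in> T_neg" "nrm ?s \<le> nrm (f a)" "nrm ?s = nrm (f a) \<longrightarrow> ?s \<in> T_neg"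
      | "?s \<in> T_neg" "nrm (f a) \<le> nrm ?s" "nrm (f a) = nrm ?s \<longrightarrow> f a \<in> T_neg"
      unfolding neg_plus by blast
    then show ?R
    proof cases
      case 1
      have "nrm (f j) \<le> nrm (f a) \<and> (nrm (f j) = nrm (f a) \<longrightarrow> f j \<in> T_neg)" if "j \<in> I" for j
      proof -
        have "f j \<in> T_neg" if eq: "nrm (f j) = nrm (f a)"
        proof -
          have "nrm ?s = nrm (f a)" using eq 1 le[OF \<open>j \<in> I\<close>] by simp
          then obtain i where "i \<in> I" "\<forall>j\<in>I. nrm (f j) \<le> nrm (f i) \<and> (nrm (f j) = nrm (f i) \<longrightarrow> f j \<in> T_neg)"
            using 1 insert.IH by blast
          moreover from this have "nrm (f i) = nrm (f j)"
            using le \<open>nrm ?s = nrm (f a)\<close> eq \<open>j \<in> I\<close> by (metis antisym)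
          ultimately show ?thesis using \<open>j \<in> I\<close> by simp
        qed
        then show ?thesis using 1 le[OF that] by simp
      qed
      then show ?thesis using 1 by auto
    next
      case 2
      then obtain i where i: "i \<in> I" "f i \<in> T_neg"
        "\<forall>j\<in>I. nrm (f j) \<le> nrm (f i) \<and> (nrm (f j) = nrm (f i) \<longrightarrow> f j \<in> T_neg)"
        using insert.IH by blast
      have "?s \<noteq> 0" using 2 by (auto simp: T_neg_iff zero_symtrop_def)
      then have "nrm (f i) = nrm ?s" using sum_nrm_attained[of I f] insert(1) i le by (metis antisym)
      then show ?thesis using i 2 by auto
    qed
  next
    assume ?R
    then obtain i where i: "i \<in> insert a I" "f i \<in> T_neg"
        "\<forall>j\<in>insert a I. nrm (f j) \<le> nrm (f i) \<and> (nrm (f j) = nrm (f i) \<longrightarrow> f j \<in> T_neg)"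
      by blast
    have snn: "?s = 0 \<or> (\<exists>j\<in>I. nrm (f j) = nrm ?s)" using sum_nrm_attained insert(1) by blast
    have "f a + ?s \<in> T_neg"
    proof (cases "i \<in> I")
      case True
      then have "?s \<in> T_neg" using insert.IH i by blast
      moreover have "nrm ?s = nrm (f i)"
      proof -
        have "?s \<noteq> 0" using calculation by (auto simp: T_neg_iff zero_symtrop_def)
        then show ?thesis using snn le[OF True] i by (metis antisym insertCI)
      qed
      ultimately show ?thesis unfolding neg_plus using i by auto
    next
      case False
      then have "i = a" using i by auto
      have "nrm ?s \<le> nrm (f a)" using snn i \<open>i = a\<close> by (auto) 
      moreover have "?s \<in> T_neg" if eq: "nrm ?s = nrm (f a)"
      proof -
        have "?s \<noteq> 0" using i \<open>i = a\<close> eq by (auto simp: T_neg_iff zero_symtrop_def)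
        then obtain j where "j \<in> I" "nrm (f j) = nrm ?s" using snn by blast
        then have "f j \<in> T_neg \<and> (\<forall>k\<in>I. nrm (f k) \<le> nrm (f j) \<and> (nrm (f k) = nrm (f j) \<longrightarrow> f k \<in> T_neg))"
          using i \<open>i = a\<close> eq by auto
        then show ?thesis using insert.IH \<open>j \<in> I\<close> by blast
      qed
      ultimately show ?thesis unfolding neg_plus using i \<open>i = a\<close> by auto
    qed
    then show ?L using insert by simp
  qed
qed

lemma signed_vecs_nth: "x \<in> signed_vecs \<Longrightarrow> x $ i \<in> T_signed"
  by (auto simp: signed_vecs_def)

lemma signed_vecs_smult [intro]:
  "c \<in> T_signed \<Longrightarrow> x \<in> signed_vecs \<Longrightarrow> c *s x \<in> signed_vecs"
  by (auto simp: signed_vecs_def)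

lemma signed_vecs_left_sum [intro]:
  "x \<in> signed_vecs \<Longrightarrow> y \<in> signed_vecs \<Longrightarrow> left_sum_vec x y \<in> signed_vecs"
  by (auto simp: signed_vecs_def left_sum_vec_def)

lemma left_sum_vec_nth [simp]: "left_sum_vec x y $ k = left_sum (x $ k) (y $ k)"
  by (simp add: left_sum_vec_def)

text \<open>Nonnegative numbers cannot tie with different signs, so their sum is simply the
  maximum.\<close>

lemma sum_eq_one_iff:
  assumes "finite I" "\<And>x. x \<in> I \<Longrightarrow> l x \<in> T_nonneg"
  shows "(\<Sum>x\<in>I. l x) = 1 \<longleftrightarrow> (\<forall>x\<in>I. nrm (l x) \<le> 1) \<and> (\<exists>x\<in>I. l x = 1)"
proof -
  have nn: "(\<Sum>x\<in>I. l x) \<in> T_nonneg"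
    using assms by (induction I rule: finite_induct) auto
  show ?thesis
  proof
    assume eq: "(\<Sum>x\<in>I. l x) = 1"
    then have "\<exists>x\<in>I. nrm (l x) = 1" using sum_nrm_attained[OF assms(1), of l] by auto
    then have "\<exists>x\<in>I. l x = 1" using assms(2) by (metis nonneg_eqI nrm_one signed_simps(4))
    then show "(\<forall>x\<in>I. nrm (l x) \<le> 1) \<and> (\<exists>x\<in>I. l x = 1)"
      using sum_nrm_le[OF assms(1), of _ l] eq by (metis nrm_one)
  next
    assume R: "(\<forall>x\<in>I. nrm (l x) \<le> 1) \<and> (\<exists>x\<in>I. l x = 1)"
    then obtain x where "x \<in> I" "l x = 1" by blast
    then have ge: "nrm (\<Sum>x\<in>I. l x) \<ge> 1" using sum_nrm_le[OF assms(1), of x l] by simp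
    then have "(\<Sum>x\<in>I. l x) \<noteq> 0" by auto
    then have "nrm (\<Sum>x\<in>I. l x) = 1" using sum_nrm_attained[OF assms(1), of l] R ge by force
    then show "(\<Sum>x\<in>I. l x) = 1" using nn by (intro nonneg_eqI) auto
  qed
qed

section \<open>Vertices and faces\<close>


text \<open>An enumeration of \<open>I\<close> is replaced by a rank function \<open>w\<close>. It need not be injective: ties are
  harmless as long as the entries of maximal norm and minimal rank agree.\<close>

definition vert_by :: "('i \<Rightarrow> nat) \<Rightarrow> 'i set \<Rightarrow> ('i \<Rightarrow> symtrop ^ 'n) \<Rightarrow> symtrop ^ 'n \<Rightarrow> bool" where
  "vert_by w I p v \<longleftrightarrow> (\<forall>k. (\<forall>i\<in>I. nrm (p i $ k) \<le> nrm (v $ k)) \<and>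
     (v $ k \<noteq> 0 \<longrightarrow> (\<exists>i\<in>I. p i $ k = v $ k \<and>
       (\<forall>j\<in>I. nrm (p j $ k) = nrm (v $ k) \<and> w j \<le> w i \<longrightarrow> p j $ k = v $ k))))"

text \<open>A left fold replaces its accumulator only by a strictly larger entry, so it returns the
  first entry of maximal norm. The hypotheses describe \<open>y\<close> as this entry, the initial
  value \<open>a\<close> counting as the earliest.\<close>

lemma foldl_left_sum:
  "foldl left_sum a xs = y" if
    "nrm a < nrm y \<or> a = y" "\<forall>x\<in>set xs. nrm x \<le> nrm y"
    "a = y \<or> (\<exists>ys zs. xs = ys @ y # zs \<and> (\<forall>x\<in>set ys. nrm x < nrm y))"
  using that
proof (induction xs arbitrary: a)
  case (Cons x xs)
  show ?case
  proof (cases "a = y")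
    case True
    then show ?thesis using Cons.prems Cons.IH[of a] by (simp add: left_sum_nrm)
  next
    case False
    then obtain ys zs where yz: "x # xs = ys @ y # zs" "\<forall>x\<in>set ys. nrm x < nrm y"
      using Cons.prems by blast
    show ?thesis
    proof (cases ys)
      case Nil
      then show ?thesis using False Cons yz by (simp add: left_sum_nrm)
    next
      case (Cons b bs)
      then have "nrm (left_sum a x) < nrm y" using yz \<open>a \<noteq> y\<close> Cons.prems by (auto simp: left_sum_nrm)
      then show ?thesis using yz Cons Cons.prems Cons.IH[of "left_sum a x"] by auto
    qed
  qed
qed auto

text \<open>Conversely, the result is always the initial value or the first entry of maximal norm.
  The initial value is arbitrary because the accumulator changes in the induction.\<close>

lemma foldl_left_sum_cases:
  "foldl left_sum a xs = a \<and> (\<forall>x\<in>set xs. nrm x \<le> nrm a) \<or>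
   nrm a < nrm (foldl left_sum a xs) \<and> (\<forall>x\<in>set xs. nrm x \<le> nrm (foldl left_sum a xs)) \<and>
   (\<exists>ys zs. xs = ys @ foldl left_sum a xs # zs \<and> (\<forall>x\<in>set ys. nrm x < nrm (foldl left_sum a xs)))"
proof (induction xs arbitrary: a)
  case (Cons x xs)
  show ?case
  proof (cases "nrm a < nrm x")
    case True
    then have eq: "foldl left_sum a (x # xs) = foldl left_sum x xs" by (simp add: left_sum_nrm)
    show ?thesis using Cons[of x] True unfolding eq
    proof (elim disjE conjE exE)
      assume "foldl left_sum x xs = x" "\<forall>xa\<in>set xs. nrm xa \<le> nrm x"
      moreover have "x # xs = [] @ x # xs" by simp
      ultimately show "foldl left_sum x xs = a \<and> (\<forall>x\<in>set (x # xs). nrm x \<le> nrm a) \<or>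
        nrm a < nrm (foldl left_sum x xs) \<and> (\<forall>xa\<in>set (x # xs). nrm xa \<le> nrm (foldl left_sum x xs)) \<and>
        (\<exists>ys zs. x # xs = ys @ foldl left_sum x xs # zs \<and> (\<forall>xa\<in>set ys. nrm xa < nrm (foldl left_sum x xs)))"
        using True by (metis empty_iff empty_set order_refl set_ConsD)
    next
      fix ys zs
      assume *: "nrm x < nrm (foldl left_sum x xs)" "\<forall>xa\<in>set xs. nrm xa \<le> nrm (foldl left_sum x xs)"
        "xs = ys @ foldl left_sum x xs # zs" "\<forall>xa\<in>set ys. nrm xa < nrm (foldl left_sum x xs)"
      then have "x # xs = (x # ys) @ foldl left_sum x xs # zs" by simp
      moreover have "\<forall>xa\<in>set (x # ys). nrm xa < nrm (foldl left_sum x xs)" using * by simp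
      moreover have "nrm a < nrm (foldl left_sum x xs)" using * True by simp
      moreover have "\<forall>xa\<in>set (x # xs). nrm xa \<le> nrm (foldl left_sum x xs)" using * by simp
      ultimately show "foldl left_sum x xs = a \<and> (\<forall>x\<in>set (x # xs). nrm x \<le> nrm a) \<or>
        nrm a < nrm (foldl left_sum x xs) \<and> (\<forall>xa\<in>set (x # xs). nrm xa \<le> nrm (foldl left_sum x xs)) \<and>
        (\<exists>ys zs. x # xs = ys @ foldl left_sum x xs # zs \<and> (\<forall>xa\<in>set ys. nrm xa < nrm (foldl left_sum x xs)))"
        by blast
    qed
  next
    case False
    then have eq: "foldl left_sum a (x # xs) = foldl left_sum a xs" by (simp add: left_sum_nrm)
    show ?thesis using Cons[of a] False unfolding eq
    proof (elim disjE conjE exE)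
      fix ys zs
      assume *: "nrm a < nrm (foldl left_sum a xs)" "\<forall>xa\<in>set xs. nrm xa \<le> nrm (foldl left_sum a xs)"
        "xs = ys @ foldl left_sum a xs # zs" "\<forall>xa\<in>set ys. nrm xa < nrm (foldl left_sum a xs)"
      then have "x # xs = (x # ys) @ foldl left_sum a xs # zs" by simp
      moreover have "\<forall>xa\<in>set (x # ys). nrm xa < nrm (foldl left_sum a xs)" using * False by simp
      moreover have "\<forall>xa\<in>set (x # xs). nrm xa \<le> nrm (foldl left_sum a xs)" using * False by simp
      ultimately show "foldl left_sum a xs = a \<and> (\<forall>x\<in>set (x # xs). nrm x \<le> nrm a) \<or>
        nrm a < nrm (foldl left_sum a xs) \<and> (\<forall>xa\<in>set (x # xs). nrm xa \<le> nrm (foldl left_sum a xs)) \<and>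
        (\<exists>ys zs. x # xs = ys @ foldl left_sum a xs # zs \<and> (\<forall>xa\<in>set ys. nrm xa < nrm (foldl left_sum a xs)))"
        using *(1) by blast
    qed (auto)
  qed
qed auto

lemma foldl_left_sum_vec_nth:
  "foldl left_sum_vec a (map p js) $ k = foldl left_sum (a $ k) (map (\<lambda>i. p i $ k) js)"
  by (induction js arbitrary: a) auto

text \<open>An enumeration ranks each point by its position; a ranking is turned back into an
  enumeration by sorting.\<close>

lemma Vert_iff:
  assumes "finite I"
  shows "v \<in> Vert I p \<longleftrightarrow> (\<exists>w. vert_by w I p v)"
proof
  assume "v \<in> Vert I p"
  then obtain js where js: "set js = I" "distinct js" and v: "v = foldl left_sum_vec 0 (map p js)"
    by (auto simp: Vert_def permutations_of_set_def)
  define w where "w j = length (takeWhile (\<lambda>x. x \<noteq> j) js)" for j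
  have "(\<forall>i\<in>I. nrm (p i $ k) \<le> nrm (v $ k)) \<and>
     (v $ k \<noteq> 0 \<longrightarrow> (\<exists>i\<in>I. p i $ k = v $ k \<and>
       (\<forall>j\<in>I. nrm (p j $ k) = nrm (v $ k) \<and> w j \<le> w i \<longrightarrow> p j $ k = v $ k)))" for k
  proof -
    have vk: "v $ k = foldl left_sum 0 (map (\<lambda>i. p i $ k) js)"
      unfolding v foldl_left_sum_vec_nth by simp
    have le: "\<forall>i\<in>I. nrm (p i $ k) \<le> nrm (v $ k)"
      using foldl_left_sum_cases[of 0 "map (\<lambda>i. p i $ k) js"] js unfolding vk[symmetric] by auto
    moreover have "\<exists>i\<in>I. p i $ k = v $ k \<and>
       (\<forall>j\<in>I. nrm (p j $ k) = nrm (v $ k) \<and> w j \<le> w i \<longrightarrow> p j $ k = v $ k)" if nz: "v $ k \<noteq> 0"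
    proof -
      obtain ys zs where "map (\<lambda>i. p i $ k) js = ys @ v $ k # zs" "\<forall>x\<in>set ys. nrm x < nrm (v $ k)"
        using foldl_left_sum_cases[of 0 "map (\<lambda>i. p i $ k) js"] nz unfolding vk[symmetric] by auto
      then obtain as i bs where j: "js = as @ i # bs" "p i $ k = v $ k" "\<forall>j\<in>set as. nrm (p j $ k) < nrm (v $ k)"
        by (auto simp: map_eq_append_conv map_eq_Cons_conv)
      have "p j $ k = v $ k" if "j \<in> I" "nrm (p j $ k) = nrm (v $ k)" "w j \<le> w i" for j
      proof (rule ccontr)
        assume "p j $ k \<noteq> v $ k"
        then have "j \<noteq> i" "j \<notin> set as" using j that by auto
        moreover have "i \<notin> set as" using js j by auto
        ultimately have "w i = length as" "w j > length as"
          unfolding w_def j(1) by (auto simp: takeWhile_append)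
        then show False using that by simp
      qed
      then show ?thesis using j js by (intro bexI[of _ i]) auto
    qed
    ultimately show ?thesis by blast
  qed
  then show "\<exists>w. vert_by w I p v" unfolding vert_by_def by blast
next
  assume "\<exists>w. vert_by w I p v"
  then obtain w where w: "vert_by w I p v" by blast
  obtain js0 where js0: "set js0 = I" "distinct js0" using finite_distinct_list[OF assms] by blast
  define js where "js = sort_key w js0"
  have js: "set js = I" "distinct js" "sorted (map w js)" using js0 by (auto simp: js_def)
  have "foldl left_sum_vec 0 (map p js) $ k = v $ k" for k
  proof -
    have "v $ k = 0 \<or> (\<exists>ys zs. map (\<lambda>i. p i $ k) js = ys @ v $ k # zs \<and> (\<forall>x\<in>set ys. nrm x < nrm (v $ k)))"
    proof (cases "v $ k = 0")
      case False
      then obtain i where i: "i \<in> I" "p i $ k = v $ k"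
        "\<forall>j\<in>I. nrm (p j $ k) = nrm (v $ k) \<and> w j \<le> w i \<longrightarrow> p j $ k = v $ k"
        using w unfolding vert_by_def by blast
      then have "\<exists>j\<in>set js. nrm (p j $ k) = nrm (v $ k)" using js by metis
      \<comment> \<open>The first entry \<open>j\<close> of maximal norm in sorted order has rank at
        most that of \<open>i\<close>, so the tie clause of \<open>vert_by\<close> forces its value,
        however equal ranks were ordered.\<close>
      then obtain as j bs where j: "js = as @ j # bs" "nrm (p j $ k) = nrm (v $ k)"
        "\<forall>a\<in>set as. nrm (p a $ k) \<noteq> nrm (v $ k)"
        using split_list_first_prop[of js "\<lambda>j. nrm (p j $ k) = nrm (v $ k)"] by blast
      have "\<forall>a\<in>set as. nrm (p a $ k) < nrm (v $ k)"
        using j w js unfolding vert_by_def by (auto simp: order_less_le)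
      moreover have "p j $ k = v $ k"
      proof -
        have "i \<in> set (j # bs)" using i j js by auto
        then have "w j \<le> w i" using js(3) j(1) by (auto simp: sorted_append)
        then show ?thesis using i j js by auto
      qed
      ultimately show ?thesis using j
        by (intro disjI2 exI[of _ "map (\<lambda>i. p i $ k) as"] exI[of _ "map (\<lambda>i. p i $ k) bs"]) auto
    qed simp
    then show ?thesis
      unfolding foldl_left_sum_vec_nth using w js unfolding vert_by_def
      by (intro foldl_left_sum) auto
  qed
  then have "foldl left_sum_vec 0 (map p js) = v" by (simp add: vec_eq_iff)
  then show "v \<in> Vert I p" unfolding Vert_def permutations_of_set_def using js by blast
qed

text \<open>If \<open>n\<close> lists the norms of the coordinates of the sum, the corners are the vertices of the
  smallest face of the hypercube that contains \<open>z\<close>. Only this face has to be tested for membership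
  of \<open>z\<close> in \<^const>\<open>Faces\<close>.\<close>

definition is_corner :: "('n \<Rightarrow> real) \<Rightarrow> symtrop ^ 'n \<Rightarrow> symtrop ^ 'n \<Rightarrow> bool" where
  "is_corner n z v \<longleftrightarrow> v \<in> signed_vecs \<and>
     (\<forall>k. nrm (v $ k) = n k \<and> (nrm (z $ k) = n k \<longrightarrow> v $ k = z $ k))"

text \<open>This is membership in \<open>Faces\<close> without mentioning the hypercube. The norms
  \<open>n\<close> are forced: a corner exists, and being attained by a ranking makes
  \<open>n\<close> the norms of the sum. The ranking \<open>w\<close> depends on the corner.\<close>

definition filled :: "'i set \<Rightarrow> ('i \<Rightarrow> symtrop ^ 'n) \<Rightarrow> symtrop ^ 'n \<Rightarrow> ('n \<Rightarrow> real) \<Rightarrow> bool" where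
  "filled I p z n \<longleftrightarrow> z \<in> signed_vecs \<and> (\<forall>k. nrm (z $ k) \<le> n k) \<and>
     (\<forall>v. is_corner n z v \<longrightarrow> (\<exists>w. vert_by w I p v))"

text \<open>Among signed numbers the interval from \<ominus>r to r is the norm ball of radius |r|,
  which eliminates the order from faces.\<close>

lemma U_set_iff: "x \<in> U_set s \<longleftrightarrow>
   (if s \<in> T_bal then x \<in> T_signed \<and> nrm x \<le> nrm s else x = s)"
proof (cases "s \<in> T_bal \<and> x \<in> T_signed")
  case True
  then show ?thesis
    by (auto simp: U_set_def T_iffs less_eq_symtrop_def less_symtrop_def split: if_splits)
next
  case False
  then show ?thesis by (auto simp: U_set_def)
qed

lemma signed_or_bal: "s \<in> T_signed \<or> s \<in> T_bal"
proof (cases s)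
  case (TNum t a)
  then show ?thesis by (cases t) (auto simp: T_iffs)
qed (auto simp: T_iffs)

lemma is_face_nrm: "is_face s' s \<Longrightarrow> nrm (s' $ k) = nrm (s $ k)"
  unfolding is_face_def abs_eq_iff_nrm by metis

text \<open>This inverts \<open>nrm\<close> once a sign is prescribed; norm 0 is separate because no
  logarithm represents minus infinity.\<close>

definition corner_sgn :: "tsgn \<Rightarrow> real \<Rightarrow> symtrop" where
  "corner_sgn t r = (if r = 0 then 0 else TNum t (ln r))"

lemma nrm_corner_sgn [simp]: "0 \<le> r \<Longrightarrow> nrm (corner_sgn t r) = r"
  by (simp add: corner_sgn_def)

lemma corner_sgn_signed [simp]: "t \<noteq> Bal \<Longrightarrow> corner_sgn t r \<in> T_signed"
  by (cases t) (auto simp: corner_sgn_def T_iffs zero_symtrop_def)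

lemma is_corner_sgn:
  assumes "z \<in> signed_vecs" "\<And>k. nrm (z $ k) \<le> n k" "\<And>k. t k \<noteq> Bal"
  shows "is_corner n z (\<chi> k. if nrm (z $ k) = n k then z $ k else corner_sgn (t k) (n k))"
proof -
  have "0 \<le> n k" for k using assms(2)[of k] nrm_nonneg[of "z $ k"] by linarith
  then show ?thesis using assms by (auto simp: is_corner_def signed_vecs_def)
qed

text \<open>A face all of whose vertices lie in \<open>Vert\<close> contains the smallest face
  around \<open>z\<close>, whose vertices are the corners; so it suffices to test that one.\<close>

lemma Faces_iff:
  assumes "finite I" "\<And>i. i \<in> I \<Longrightarrow> p i \<in> signed_vecs"
  shows "z \<in> Faces I p \<longleftrightarrow> (\<exists>n. filled I p z n)"
proof
  define s where "s = (\<Sum>i\<in>I. p i)"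
  assume "z \<in> Faces I p"
  then obtain s' where s': "is_face s' s" "\<forall>v\<in>signed_vecs. is_face v s' \<longrightarrow> v \<in> Vert I p" "z \<in> U_cube s'"
    unfolding Faces_def s_def by blast
  have z: "z $ k \<in> U_set (s' $ k)" for k using s' by (auto simp: U_cube_def)
  have zs: "z $ k \<in> T_signed" and le: "nrm (z $ k) \<le> nrm (s' $ k)" for k
    using z[of k] signed_or_bal[of "s' $ k"] by (auto simp: U_set_iff split: if_splits)
  have "filled I p z (\<lambda>k. nrm (s' $ k))"
    unfolding filled_def
  proof (intro conjI allI impI)
    show "z \<in> signed_vecs" using zs by (simp add: signed_vecs_def)
    show "nrm (z $ k) \<le> nrm (s' $ k)" for k using le by simp
    fix v assume v: "is_corner (\<lambda>k. nrm (s' $ k)) z v"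
    have "is_face v s'" unfolding is_face_def abs_eq_iff_nrm
    proof (intro allI)
      fix k
      have "v $ k = s' $ k" if "s' $ k \<in> T_signed"
      proof (cases "s' $ k \<in> T_bal")
        case True
        then have "s' $ k = 0" using that by (auto simp: T_iffs zero_symtrop_def)
        then show ?thesis using v by (metis is_corner_def nrm_eq_0_iff nrm_zero)
      next
        case False
        then have "z $ k = s' $ k" using z[of k] by (simp add: U_set_iff)
        then show ?thesis using v by (simp add: is_corner_def)
      qed
      then show "if s' $ k \<in> T_signed then v $ k = s' $ k else nrm (v $ k) = nrm (s' $ k)"
        using v by (simp add: is_corner_def)
    qed
    then have "v \<in> Vert I p" using s' v by (simp add: is_corner_def)
    then show "\<exists>w. vert_by w I p v" using Vert_iff[OF assms(1)] by blast
  qed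
  then show "\<exists>n. filled I p z n" by blast
next
  define s where "s = (\<Sum>i\<in>I. p i)"
  assume "\<exists>n. filled I p z n"
  then obtain n where n: "filled I p z n" by blast
  then have zs: "z $ k \<in> T_signed" and le: "nrm (z $ k) \<le> n k" for k
    by (auto simp: filled_def signed_vecs_def)
  define c where "c t = (\<chi> k. if nrm (z $ k) = n k then z $ k else corner_sgn t (n k))" for t
  have c: "is_corner n z (c t)" if "t \<noteq> Bal" for t
    unfolding c_def using n that by (intro is_corner_sgn) (auto simp: filled_def)
  have sk: "s $ k = (\<Sum>i\<in>I. p i $ k)" for k by (simp add: s_def)
  have nonneg: "0 \<le> n k" for k using le[of k] nrm_nonneg[of "z $ k"] by linarith
  \<comment> \<open>The entries of a corner dominate all points and are attained by some point,
    hence have the norms of the sum; where the sum is signed, the attaining entry equals it.\<close>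
  have ns: "nrm (s $ k) = n k \<and> (s $ k \<in> T_signed \<longrightarrow> v $ k = s $ k)" if v: "is_corner n z v" for v k
  proof -
    obtain w where w: "vert_by w I p v" using v n unfolding filled_def by blast
    have vn: "nrm (v $ k) = n k" using v by (simp add: is_corner_def)
    have ge: "nrm (p i $ k) \<le> nrm (s $ k)" if "i \<in> I" for i
      using sum_nrm_le[OF assms(1) that] by (simp add: sk)
    have lev: "nrm (p i $ k) \<le> nrm (v $ k)" if "i \<in> I" for i
      using w that by (simp add: vert_by_def)
    have sle: "nrm (s $ k) \<le> nrm (v $ k)"
    proof (cases "s $ k = 0")
      case False
      then obtain i where "i \<in> I" "nrm (p i $ k) = nrm (s $ k)"
        using sum_nrm_attained[OF assms(1), of "\<lambda>i. p i $ k"] unfolding sk[symmetric] by blast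
      then show ?thesis using lev by metis
    qed simp
    show ?thesis
    proof (cases "v $ k = 0")
      case True
      then have "s $ k = 0" using sle by (metis nrm_pos_iff nrm_zero not_less)
      then show ?thesis using True vn by simp
    next
      case False
      then obtain i where i: "i \<in> I" "p i $ k = v $ k" using w unfolding vert_by_def by blast
      then have "nrm (v $ k) \<le> nrm (s $ k)" using ge by metis
      moreover note sle
      moreover have "p i $ k = s $ k" if "s $ k \<in> T_signed" "nrm (s $ k) = nrm (v $ k)"
        unfolding sk using that i assms
        by (intro sum_signed_term) (auto simp: sk[symmetric] signed_vecs_nth)
      ultimately show ?thesis using vn i by auto
    qed
  qed
  \<comment> \<open>Keeping the coordinates in which \<open>z\<close> has full norm and balancing
    the others spans the smallest face containing \<open>z\<close>.\<close>
  define s' where "s' = (\<chi> k. if nrm (z $ k) = n k then z $ k else corner_sgn Bal (n k))"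
  have "is_face s' s" unfolding is_face_def abs_eq_iff_nrm
  proof (intro allI)
    fix k
    have "s' $ k = s $ k" if "s $ k \<in> T_signed"
    proof (cases "nrm (z $ k) = n k")
      case True
      then show ?thesis using ns[OF c[of Pos], of k] that by (simp add: s'_def c_def)
    next
      case False
      then have "n k \<noteq> 0" using le[of k] nrm_nonneg[of "z $ k"] by linarith
      \<comment> \<open>In a free coordinate both signs occur among the corners, and a signed entry
        of \<open>s\<close> would have to equal both.\<close>
      moreover have "corner_sgn Pos (n k) = corner_sgn Neg (n k)"
        using False ns[OF c[of Pos], of k] ns[OF c[of Neg], of k] that by (simp add: c_def)
      ultimately show ?thesis by (simp add: corner_sgn_def)
    qed
    moreover have "nrm (s' $ k) = nrm (s $ k)" using ns[OF c[of Pos], of k] nonneg by (simp add: s'_def)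
    ultimately show "if s $ k \<in> T_signed then s' $ k = s $ k else nrm (s' $ k) = nrm (s $ k)" by simp
  qed
  moreover have "v \<in> Vert I p" if v: "v \<in> signed_vecs" "is_face v s'" for v
  proof -
    have "nrm (v $ k) = n k" for k using is_face_nrm[OF v(2), of k] nonneg by (simp add: s'_def)
    moreover have "v $ k = z $ k" if "nrm (z $ k) = n k" for k
    proof -
      have "s' $ k = z $ k" using that by (simp add: s'_def)
      then show ?thesis using v(2) zs[of k] unfolding is_face_def by metis
    qed
    ultimately have "is_corner n z v" using v by (simp add: is_corner_def)
    then show ?thesis using n unfolding Vert_iff[OF assms(1)] filled_def by blast
  qed
  moreover have "z \<in> U_cube s'"
  proof -
    have "z $ k \<in> U_set (s' $ k)" for k
    proof (cases "nrm (z $ k) = n k")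
      case True
      then show ?thesis by (auto simp: s'_def U_set_iff zs)
    next
      case False
      then have "s' $ k = corner_sgn Bal (n k)" by (simp add: s'_def)
      moreover from this have "s' $ k \<in> T_bal" by (simp add: corner_sgn_def T_bal_iff zero_symtrop_def)
      ultimately show ?thesis using le[of k] zs[of k] nonneg[of k] by (simp add: U_set_iff)
    qed
    then show ?thesis by (simp add: U_cube_def)
  qed
  ultimately show "z \<in> Faces I p" unfolding Faces_def s_def by blast
qed

section \<open>Faces lie in TC-convex sets\<close>


text \<open>Homogenisation: \<open>None\<close> carries the constant term of a halfspace, or the
  entry \<open>1\<close> of a point, so that an affine form becomes one sum over
  \<open>'n option\<close>.\<close>

definition homog :: "symtrop \<Rightarrow> symtrop ^ 'n \<Rightarrow> 'n option \<Rightarrow> symtrop" where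
  "homog c x i' = (case i' of None \<Rightarrow> c | Some i \<Rightarrow> x $ i)"

lemma homog_simps [simp]: "homog c x None = c" "homog c x (Some i) = x $ i"
  by (simp_all add: homog_def)

lemma closed_halfspace_iff:
  "x \<in> closed_halfspace a0 a \<longleftrightarrow>
     x \<in> signed_vecs \<and> (\<Sum>i\<in>UNIV. homog a0 a i * homog 1 x i) \<notin> T_neg"
proof -
  have "(\<Sum>i\<in>UNIV. homog a0 a i * homog 1 x i) = a0 + (\<Sum>i\<in>UNIV. a $ i * x $ i)"
    by (simp add: UNIV_option_conv sum.reindex)
  then show ?thesis unfolding closed_halfspace_def pos_or_bal_iff by simp
qed

lemma neg_mult_nonneg:
  assumes "c \<in> T_nonneg" "c * x \<in> T_neg" shows "x \<in> T_neg"
  using assms by (cases x) (auto simp: T_iffs)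

text \<open>A sum is negative iff all of its terms of maximal norm are. If one of these terms stems from
  \<open>x\<close>, then the sum over \<open>x\<close> is negative, and otherwise the sum over \<open>y\<close> is.\<close>

lemma sum_neg_left_sum:
  assumes "finite F" and neg: "(\<Sum>i\<in>F. a i * left_sum (x i) (y i)) \<in> T_neg"
  shows "(\<Sum>i\<in>F. a i * x i) \<in> T_neg \<or> (\<Sum>i\<in>F. a i * y i) \<in> T_neg"
proof -
  define g where "g i = a i * left_sum (x i) (y i)" for i
  have "(\<Sum>i\<in>F. g i) \<in> T_neg" using neg by (simp add: g_def)
  then obtain i where i: "i \<in> F" "g i \<in> T_neg"
    and le: "\<And>j. j \<in> F \<Longrightarrow> nrm (g j) \<le> nrm (g i)"
    and eq: "\<And>j. j \<in> F \<Longrightarrow> nrm (g j) = nrm (g i) \<Longrightarrow> g j \<in> T_neg"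
    unfolding sum_neg_iff[OF assms(1)] by blast
  have nz: "nrm (g i) > 0" using i by (auto simp: T_neg_iff zero_symtrop_def)
  have gx: "nrm (a j * x j) \<le> nrm (g j)" and gy: "nrm (a j * y j) \<le> nrm (g j)" for j
    by (auto simp: g_def left_sum_nrm intro!: mult_left_mono)
  show ?thesis
  proof (cases "\<exists>j\<in>F. nrm (g j) = nrm (g i) \<and> nrm (y j) \<le> nrm (x j)")
    case True
    then obtain j where j: "j \<in> F" "nrm (g j) = nrm (g i)" "nrm (y j) \<le> nrm (x j)" by blast
    then have gj: "g j = a j * x j" by (simp add: g_def left_sum_nrm)
    have "a k * x k \<in> T_neg" if k: "k \<in> F" "nrm (a k * x k) = nrm (a j * x j)" for k
    proof -
      have "nrm (g k) = nrm (a k * x k)" using gx[of k] le[OF k(1)] k j gj by simp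
      moreover from this have "a k \<noteq> 0" using k j gj nz by auto
      ultimately have "g k = a k * x k" by (auto simp: g_def left_sum_nrm)
      then show ?thesis using eq[OF k(1)] k j gj by simp
    qed
    moreover have "nrm (a k * x k) \<le> nrm (a j * x j)" if "k \<in> F" for k
      using gx[of k] le[OF that] j gj by simp
    moreover have "a j * x j \<in> T_neg" using eq[OF j(1,2)] gj by simp
    ultimately have "(\<Sum>i\<in>F. a i * x i) \<in> T_neg"
      unfolding sum_neg_iff[OF assms(1)] using j(1) by blast
    then show ?thesis by blast
  next
    case False
    then have F: "nrm (x k) < nrm (y k)" if "k \<in> F" "nrm (g k) = nrm (g i)" for k
      using that by force
    have gi: "g i = a i * y i" using F[OF i(1)] by (simp add: g_def left_sum_nrm)
    have "a k * y k \<in> T_neg" if k: "k \<in> F" "nrm (a k * y k) = nrm (a i * y i)" for k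
    proof -
      have "nrm (g k) = nrm (g i)" using gy[of k] le[OF k(1)] k gi by simp
      moreover from F[OF k(1) this] have "g k = a k * y k" by (simp add: g_def left_sum_nrm)
      ultimately show ?thesis using eq[OF k(1)] by simp
    qed
    moreover have "nrm (a k * y k) \<le> nrm (a i * y i)" if "k \<in> F" for k
      using gy[of k] le[OF that] gi by simp
    moreover have "a i * y i \<in> T_neg" using i gi by simp
    ultimately have "(\<Sum>i\<in>F. a i * y i) \<in> T_neg"
      unfolding sum_neg_iff[OF assms(1)] using i(1) by blast
    then show ?thesis by blast
  qed
qed

text \<open>Because \<open>l + m = 1\<close>, also the extra homogeneous coordinate is a left sum of
  those of \<open>l *s u\<close> and \<open>m *s v\<close>. A halfspace violated by the left sum is
  then violated by a nonnegative multiple of \<open>u\<close> or \<open>v\<close>.\<close>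

lemma left_sum_in_conv_TC2:
  assumes "u \<in> signed_vecs" "v \<in> signed_vecs" "l \<in> T_nonneg" "m \<in> T_nonneg" "l + m = 1"
  shows "left_sum_vec (l *s u) (m *s v) \<in> conv_TC2 u v"
proof -
  let ?y = "left_sum_vec (l *s u) (m *s v)"
  have "?y \<in> signed_vecs" using assms by (auto intro: T_nonneg_subset)
  moreover have "?y \<in> closed_halfspace a0 a" if "u \<in> closed_halfspace a0 a" "v \<in> closed_halfspace a0 a" for a0 a
  proof (rule ccontr)
    have mx: "max (nrm l) (nrm m) = 1" using assms(5) nrm_plus[of l m] by simp
    have "left_sum l m = 1"
      using mx assms(3,4) by (auto simp: left_sum_nrm max_def intro!: nonneg_eqI split: if_splits)
    then have h: "homog 1 ?y i = left_sum (l * homog 1 u i) (m * homog 1 v i)" for i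
      by (cases i) auto
    assume "?y \<notin> closed_halfspace a0 a"
    then have "(\<Sum>i\<in>UNIV. homog a0 a i * left_sum (l * homog 1 u i) (m * homog 1 v i)) \<in> T_neg"
      using \<open>?y \<in> signed_vecs\<close> unfolding closed_halfspace_iff h by blast
    then consider "(\<Sum>i\<in>UNIV. homog a0 a i * (l * homog 1 u i)) \<in> T_neg"
      | "(\<Sum>i\<in>UNIV. homog a0 a i * (m * homog 1 v i)) \<in> T_neg"
      using sum_neg_left_sum[of UNIV "homog a0 a"] by fastforce
    then show False
    proof cases
      case 1
      then have "l * (\<Sum>i\<in>UNIV. homog a0 a i * homog 1 u i) \<in> T_neg"
        by (simp add: sum_distrib_left mult.left_commute)
      from neg_mult_nonneg[OF assms(3) this] show ?thesis using that(1) unfolding closed_halfspace_iff by blast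
    next
      case 2
      then have "m * (\<Sum>i\<in>UNIV. homog a0 a i * homog 1 v i) \<in> T_neg"
        by (simp add: sum_distrib_left mult.left_commute)
      from neg_mult_nonneg[OF assms(4) this] show ?thesis using that(2) unfolding closed_halfspace_iff by blast
    qed
  qed
  ultimately show ?thesis unfolding conv_TC2_def closed_halfspaces_def by blast
qed

text \<open>For any halfspace the terms of \<open>u\<close> and \<open>v\<close> at \<open>a\<close>
  are opposite, so one of them is negative or both vanish. If \<open>y\<close> made the sum
  negative, replacing its term at \<open>a\<close> by that one, of at least the same norm, would
  keep it negative.\<close>

lemma coordinate_fill_in_conv_TC2:
  assumes "u \<in> signed_vecs" "v \<in> signed_vecs" "y \<in> signed_vecs"
    and "\<And>k. k \<noteq> a \<Longrightarrow> y $ k = u $ k" "\<And>k. k \<noteq> a \<Longrightarrow> y $ k = v $ k"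
    and "u $ a = - v $ a" "nrm (y $ a) \<le> nrm (u $ a)"
  shows "y \<in> conv_TC2 u v"
proof -
  have "y \<in> closed_halfspace b0 b"
    if H: "u \<in> closed_halfspace b0 b" "v \<in> closed_halfspace b0 b" "b0 \<in> T_signed" "b \<in> signed_vecs" for b0 b
  proof (rule ccontr)
    define r where "r = (\<Sum>i\<in>UNIV - {Some a}. homog b0 b i * homog 1 y i)"
    have split: "(\<Sum>i\<in>UNIV. homog b0 b i * homog 1 x i) = b $ a * x $ a + r"
      if "\<And>k. k \<noteq> a \<Longrightarrow> y $ k = x $ k" for x
    proof -
      have "homog b0 b i * homog 1 x i = homog b0 b i * homog 1 y i" if "i \<in> UNIV - {Some a}" for i
        using that \<open>\<And>k. k \<noteq> a \<Longrightarrow> y $ k = x $ k\<close> by (cases i) auto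
      then show ?thesis unfolding r_def by (subst sum.remove[of _ "Some a"]) auto
    qed
    assume "y \<notin> closed_halfspace b0 b"
    then have "b $ a * y $ a + r \<in> T_neg" using assms(3) split[of y] by (simp add: closed_halfspace_iff)
    moreover have "b $ a * u $ a + r \<notin> T_neg" "b $ a * v $ a + r \<notin> T_neg"
      using H split[of u] split[of v] assms by (simp_all add: closed_halfspace_iff)
    moreover have "x + r \<in> T_neg" if "t + r \<in> T_neg" "t \<in> T_signed" "x \<in> T_neg \<or> x = TInf" "nrm t \<le> nrm x" for x t
      using that by (cases r) (auto simp: T_signed_iff T_neg_iff split: if_splits)
    moreover have "b $ a * u $ a \<in> T_neg \<or> b $ a * v $ a \<in> T_neg \<or> b $ a * u $ a = TInf"
      using assms(6) signed_vecs_nth[OF H(4), of a] signed_vecs_nth[OF assms(2), of a]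
      by (auto simp: T_signed_iff T_neg_iff)
    moreover have "nrm (b $ a * y $ a) \<le> nrm (b $ a * u $ a)" "nrm (b $ a * u $ a) = nrm (b $ a * v $ a)"
      using assms(6,7) by (auto intro!: mult_left_mono)
    moreover have "b $ a * y $ a \<in> T_signed"
      using signed_vecs_nth[OF H(4), of a] signed_vecs_nth[OF assms(3), of a] by auto
    ultimately show False by metis
  qed
  then show ?thesis using assms(3) unfolding conv_TC2_def closed_halfspaces_def by blast
qed

text \<open>These are the admissible coefficients before any bound on the support is
  imposed.\<close>

definition comb :: "(symtrop ^ 'n) set \<Rightarrow> (symtrop ^ 'n \<Rightarrow> symtrop) \<Rightarrow> bool" where
  "comb X l \<longleftrightarrow> l \<in> X \<rightarrow> T_nonneg \<and> finite (tsupp X l) \<and> (\<Sum>x\<in>tsupp X l. l x) = 1"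

lemma comb_iff:
  "comb X l \<longleftrightarrow> l \<in> X \<rightarrow> T_nonneg \<and> finite (tsupp X l) \<and> (\<forall>x\<in>X. nrm (l x) \<le> 1) \<and> (\<exists>x\<in>X. l x = 1)"
proof -
  have "(\<Sum>x\<in>tsupp X l. l x) = 1 \<longleftrightarrow> (\<forall>x\<in>X. nrm (l x) \<le> 1) \<and> (\<exists>x\<in>X. l x = 1)"
    if "l \<in> X \<rightarrow> T_nonneg" "finite (tsupp X l)"
  proof -
    have "(\<Sum>x\<in>tsupp X l. l x) = 1 \<longleftrightarrow> (\<forall>x\<in>tsupp X l. nrm (l x) \<le> 1) \<and> (\<exists>x\<in>tsupp X l. l x = 1)"
      using that by (intro sum_eq_one_iff) (auto simp: tsupp_def)
    also have "\<dots> \<longleftrightarrow> (\<forall>x\<in>X. nrm (l x) \<le> 1) \<and> (\<exists>x\<in>X. l x = 1)"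
      by (auto simp: tsupp_def)
    finally show ?thesis .
  qed
  then show ?thesis unfolding comb_def by blast
qed

lemma tsupp_points_signed:
  assumes "X \<subseteq> signed_vecs" "l \<in> X \<rightarrow> T_nonneg" "x \<in> tsupp X l"
  shows "l x *s x \<in> signed_vecs"
  using assms by (auto simp: tsupp_def intro!: signed_vecs_smult T_nonneg_subset)

lemma smult_left_sum_vec: "c *s left_sum_vec x y = left_sum_vec (c *s x) (c *s y)"
  by (simp add: vec_eq_iff left_sum_mult)

lemma nonneg_inverse:
  assumes "m \<in> T_nonneg" "m \<noteq> 0"
  obtains m' where "m' \<in> T_nonneg" "m' * m = 1"
proof -
  obtain a where "m = TNum Pos a" using assms by (auto simp: T_nonneg_iff zero_symtrop_def)
  then show ?thesis by (intro that[of "TNum Pos (- a)"]) (auto simp: T_nonneg_iff one_symtrop_def)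
qed

text \<open>Partial left sums are not normalised and need not lie in \<open>S\<close>; splitting off
  the total \<open>m\<close> of the coefficients used so far leaves a point \<open>q\<close> that
  does.\<close>

lemma foldl_left_sum_vec_in_TC_convex:
  assumes "TC_convex S" "js \<noteq> []" "\<And>j. j \<in> set js \<Longrightarrow> j \<in> S \<and> l j \<in> T_nonneg \<and> l j \<noteq> 0"
  shows "\<exists>m q. m \<in> T_nonneg \<and> m \<noteq> 0 \<and> q \<in> S \<and> m = (\<Sum>j\<leftarrow>js. l j) \<and>
     foldl left_sum_vec 0 (map (\<lambda>x. l x *s x) js) = m *s q"
  using assms(2,3)
proof (induction js rule: rev_induct)
  case (snoc x js)
  have S: "S \<subseteq> signed_vecs" using assms(1) by (simp add: TC_convex_def)
  show ?case
  proof (cases "js = []")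
    case True
    have "left_sum_vec 0 y = y" for y :: "symtrop ^ 'a" by (simp add: vec_eq_iff left_sum_nrm)
    then show ?thesis using True snoc.prems by auto
  next
    case False
    then obtain m q where mq: "m \<in> T_nonneg" "m \<noteq> 0" "q \<in> S" "m = (\<Sum>j\<leftarrow>js. l j)"
      "foldl left_sum_vec 0 (map (\<lambda>x. l x *s x) js) = m *s q"
      using snoc.IH snoc.prems by auto
    have x: "x \<in> S" "l x \<in> T_nonneg" "l x \<noteq> 0" using snoc.prems by auto
    define m1 where "m1 = m + l x"
    have m1: "m1 \<in> T_nonneg" "m1 \<noteq> 0" using mq x unfolding m1_def
      by (auto simp: T_nonneg_iff zero_symtrop_def split: if_splits)
    then obtain m' where m': "m' \<in> T_nonneg" "m' * m1 = 1" by (rule nonneg_inverse)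
    \<comment> \<open>Division by the new total makes the two coefficients add up to
      \<open>1\<close>, so \<open>q1\<close> is in the segment of \<open>q\<close> and
      \<open>x\<close>.\<close>
    define q1 where "q1 = left_sum_vec ((m' * m) *s q) ((m' * l x) *s x)"
    have "q1 \<in> conv_TC2 q x" unfolding q1_def
      using S mq x m' m1_def by (intro left_sum_in_conv_TC2) (auto simp: algebra_simps)
    then have "q1 \<in> S" using assms(1) mq x unfolding TC_convex_def by blast
    moreover have "m1 *s q1 = left_sum_vec (m *s q) (l x *s x)"
      unfolding q1_def smult_left_sum_vec using m'(2)
      by (simp add: mult.assoc[symmetric] mult.commute[of m1 m'])
    moreover have "m1 = (\<Sum>j\<leftarrow>js @ [x]. l j)" using mq(4) m1_def by simp
    moreover have "foldl left_sum_vec 0 (map (\<lambda>x. l x *s x) (js @ [x])) = left_sum_vec (m *s q) (l x *s x)"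
      using mq(5) by simp
    ultimately show ?thesis using m1 by metis
  qed
qed simp

lemma filled_in_TC_convex:
  assumes "TC_convex S" "X \<subseteq> S" "comb X l" "filled (tsupp X l) (\<lambda>x. l x *s x) z n"
  shows "z \<in> S"
proof -
  have fin: "finite (tsupp X l)" using assms(3) by (simp add: comb_def)
  have S: "S \<subseteq> signed_vecs" using assms(1) by (simp add: TC_convex_def)
  have corner: "v \<in> S" if c: "is_corner n z v" for v
  proof -
    have "v \<in> Vert (tsupp X l) (\<lambda>x. l x *s x)"
      using c assms(4) unfolding Vert_iff[OF fin] by (simp add: filled_def)
    then obtain js where js: "set js = tsupp X l" "distinct js"
      and v: "v = foldl left_sum_vec 0 (map (\<lambda>x. l x *s x) js)"
      by (auto simp: Vert_def permutations_of_set_def)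
    have "js \<noteq> []" using js assms(3) by (auto simp: comb_def)
    moreover have "j \<in> S \<and> l j \<in> T_nonneg \<and> l j \<noteq> 0" if "j \<in> set js" for j
      using that js assms(2,3) by (auto simp: tsupp_def comb_def)
    ultimately obtain m q where mq: "q \<in> S" "m = (\<Sum>j\<leftarrow>js. l j)" "v = m *s q"
      using foldl_left_sum_vec_in_TC_convex[OF assms(1), of js l] v by blast
    moreover have "m = 1" using mq js assms(3) by (simp add: sum_list_distinct_conv_sum_set comb_def)
    ultimately show ?thesis by simp
  qed
  \<comment> \<open>\<open>A\<close> holds the coordinates in which \<open>y\<close> may fall short
    of full norm: \<open>y\<close> is a corner when \<open>A\<close> is empty, and
    \<open>A = UNIV\<close> admits \<open>z\<close> itself.\<close>
  have "y \<in> S" if "y \<in> signed_vecs" "\<forall>k. nrm (y $ k) \<le> n k \<and> (nrm (z $ k) = n k \<longrightarrow> y $ k = z $ k)"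
      "\<forall>k. k \<notin> A \<longrightarrow> nrm (y $ k) = n k" for y A
    using finite[of A] that
  proof (induction A arbitrary: y rule: finite_induct)
    case empty
    then show ?case by (intro corner) (simp add: is_corner_def)
  next
    case (insert a A)
    show ?case
    proof (cases "nrm (y $ a) = n a")
      case True
      then show ?thesis using insert.prems by (intro insert.IH) auto
    next
      case False
      have na: "0 \<le> n a" using insert.prems(2) nrm_nonneg[of "y $ a"] by (meson order_trans)
      \<comment> \<open>\<open>f Pos\<close> and \<open>f Neg\<close> push coordinate
        \<open>a\<close> of \<open>y\<close> to the two ends of its range, and \<open>y\<close> lies
        between them.\<close>
      define f where "f t = (\<chi> k. if k = a then corner_sgn t (n a) else y $ k)" for t
      have f: "f t \<in> signed_vecs" if "t \<noteq> Bal" for t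
        using insert.prems(1) that by (simp add: f_def signed_vecs_def)
      have fS: "f t \<in> S" if "t \<noteq> Bal" for t
      proof (rule insert.IH)
        have "nrm (z $ a) \<noteq> n a" using insert.prems(2) False by metis
        then show "\<forall>k. nrm (f t $ k) \<le> n k \<and> (nrm (z $ k) = n k \<longrightarrow> f t $ k = z $ k)"
          using insert.prems(2) na by (simp add: f_def)
        show "\<forall>k. k \<notin> A \<longrightarrow> nrm (f t $ k) = n k" using insert.prems(3) na by (simp add: f_def)
      qed (rule f[OF that])
      have "y \<in> conv_TC2 (f Pos) (f Neg)"
      proof (rule coordinate_fill_in_conv_TC2[of _ _ _ a])
        show "f Pos \<in> signed_vecs" "f Neg \<in> signed_vecs" using f by simp_all
        show "y $ k = f Pos $ k" "y $ k = f Neg $ k" if "k \<noteq> a" for k using that by (simp_all add: f_def)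
        show "f Pos $ a = - f Neg $ a" by (simp add: f_def corner_sgn_def zero_symtrop_def)
        show "nrm (y $ a) \<le> nrm (f Pos $ a)" using insert.prems(2) na by (simp add: f_def)
      qed fact
      moreover have "f Pos \<in> S" "f Neg \<in> S" using fS by simp_all
      ultimately show ?thesis using assms(1) unfolding TC_convex_def by blast
    qed
  qed
  from this[of z UNIV] show ?thesis using assms(4) by (auto simp: filled_def)
qed

lemma Faces_diag_in_TC_convex:
  assumes "TC_convex S" "X \<subseteq> S" "comb X l" "z \<in> Faces_diag X l"
  shows "z \<in> S"
proof -
  have "X \<subseteq> signed_vecs" using assms by (auto simp: TC_convex_def)
  then have "\<exists>n. filled (tsupp X l) (\<lambda>x. l x *s x) z n"
    using assms(3,4) tsupp_points_signed unfolding Faces_diag_def comb_def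
    by (subst (asm) Faces_iff) auto
  then show ?thesis using filled_in_TC_convex assms by blast
qed

section \<open>Left sums of points of faces\<close>


text \<open>Points contributed by the first combination are ranked before those contributed by the second.\<close>

lemma vert_by_left_sum:
  fixes X :: "(symtrop ^ 'n) set"
  assumes l: "lu \<in> X \<rightarrow> T_nonneg" "lv \<in> X \<rightarrow> T_nonneg" "c \<in> T_nonneg" "d \<in> T_nonneg"
    and fin: "finite (tsupp X lu)"
    and u: "vert_by wu (tsupp X lu) (\<lambda>x. lu x *s x) Vu"
    and v: "vert_by wv (tsupp X lv) (\<lambda>x. lv x *s x) Vv"
  shows "\<exists>w. vert_by w (tsupp X (\<lambda>x. c * lu x + d * lv x)) (\<lambda>x. (c * lu x + d * lv x) *s x)
           (left_sum_vec (c *s Vu) (d *s Vv))"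
proof -
  define I where "I = tsupp X (\<lambda>x. c * lu x + d * lv x)"
  obtain N where N: "\<And>x. x \<in> tsupp X lu \<Longrightarrow> wu x < N"
    using finite_nat_set_iff_bounded[of "wu ` tsupp X lu"] fin by auto
  \<comment> \<open>A point common to both families occurs once in the merged one.
    \<open>A x\<close> says that its coefficient is supplied by the first family, ties included, and
    thereby fixes the block in which it is ranked.\<close>
  define A where "A x \<longleftrightarrow> nrm (d * lv x) \<le> nrm (c * lu x)" for x
  define w where "w x = (if A x then wu x else N + wv x)" for x
  have pos: "c * lu x \<in> T_nonneg" "d * lv x \<in> T_nonneg" if "x \<in> X" for x
    using l that by auto
  have A: "c * lu x + d * lv x = c * lu x" "x \<in> tsupp X lu" "c * lu x \<noteq> 0" if "x \<in> I" "A x" for x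
  proof -
    show eq: "c * lu x + d * lv x = c * lu x"
      using that pos[of x] by (intro nonneg_plus_left) (auto simp: I_def A_def tsupp_def)
    show "c * lu x \<noteq> 0" using that(1) eq by (auto simp: I_def tsupp_def)
    then show "x \<in> tsupp X lu" using that by (auto simp: I_def tsupp_def)
  qed
  have B: "c * lu x + d * lv x = d * lv x" "x \<in> tsupp X lv" "d * lv x \<noteq> 0" if "x \<in> I" "\<not> A x" for x
  proof -
    show eq: "c * lu x + d * lv x = d * lv x"
      using that pos[of x] nonneg_plus_left[of "d * lv x" "c * lu x"]
      by (simp add: I_def A_def tsupp_def add.commute)
    show "d * lv x \<noteq> 0" using that(1) eq by (auto simp: I_def tsupp_def)
    then show "x \<in> tsupp X lv" using that by (auto simp: I_def tsupp_def)
  qed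
  have ule: "nrm (c * lu x * x $ k) \<le> nrm (c * Vu $ k)" if "x \<in> X" for x k
    using u that unfolding vert_by_def tsupp_def
    by (cases "lu x = 0") (auto simp: mult.assoc intro!: mult_left_mono)
  have vle: "nrm (d * lv x * x $ k) \<le> nrm (d * Vv $ k)" if "x \<in> X" for x k
    using v that unfolding vert_by_def tsupp_def
    by (cases "lv x = 0") (auto simp: mult.assoc intro!: mult_left_mono)
  have IX: "x \<in> X" if "x \<in> I" for x using that by (simp add: I_def tsupp_def)
  define V where "V = left_sum_vec (c *s Vu) (d *s Vv)"
  have V: "V $ k = left_sum (c * Vu $ k) (d * Vv $ k)" for k by (simp add: V_def)
  have nV: "nrm (V $ k) = max (nrm (c * Vu $ k)) (nrm (d * Vv $ k))" for k
    by (auto simp: V left_sum_nrm max_def)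
  have le: "nrm ((c * lu i + d * lv i) * i $ k) \<le> nrm (V $ k)" if "i \<in> I" for i k
  proof (cases "A i")
    case True
    then show ?thesis using ule[OF IX[OF that], of k] unfolding A(1)[OF that True] nV by linarith
  next
    case False
    then show ?thesis using vle[OF IX[OF that], of k] unfolding B(1)[OF that False] nV by linarith
  qed
  have ex: "\<exists>i\<in>I. (c * lu i + d * lv i) * i $ k = V $ k \<and>
       (\<forall>j\<in>I. nrm ((c * lu j + d * lv j) * j $ k) = nrm (V $ k) \<and> w j \<le> w i \<longrightarrow>
          (c * lu j + d * lv j) * j $ k = V $ k)" if nz: "V $ k \<noteq> 0" for k
  proof (cases "nrm (c * Vu $ k) < nrm (d * Vv $ k)")
    case False
    then have Vk: "V $ k = c * Vu $ k" by (simp add: V left_sum_nrm)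
    then have "Vu $ k \<noteq> 0" "c \<noteq> 0" using nz by auto
    then obtain i where i: "i \<in> tsupp X lu" "lu i * i $ k = Vu $ k"
      "\<forall>j\<in>tsupp X lu. nrm (lu j * j $ k) = nrm (Vu $ k) \<and> wu j \<le> wu i \<longrightarrow> lu j * j $ k = Vu $ k"
      using u unfolding vert_by_def by auto
    have iV: "c * lu i * i $ k = V $ k" using i Vk by (simp add: mult.assoc)
    have iX: "i \<in> X" using i by (simp add: tsupp_def)
    \<comment> \<open>Otherwise the larger second coefficient would lift the entry of
      \<open>i\<close> above the norm of \<open>V\<close> in coordinate \<open>k\<close>.\<close>
    have "A i"
    proof (rule ccontr)
      assume "\<not> A i"
      then have "nrm (c * lu i) < nrm (d * lv i)" by (simp add: A_def)
      moreover have "0 < nrm (i $ k)" using iV nz by auto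
      ultimately have "nrm (c * lu i * i $ k) < nrm (d * lv i * i $ k)"
        unfolding nrm_mult[of _ "i $ k"] by (rule mult_strict_right_mono)
      then show False using vle[OF iX, of k] False iV Vk by simp
    qed
    have "i \<in> I"
    proof -
      have "c * lu i + d * lv i = c * lu i" 
        using pos[OF iX] \<open>A i\<close> by (intro nonneg_plus_left) (simp_all add: A_def)
      moreover have "c * lu i \<noteq> 0" using iV nz by auto
      ultimately show ?thesis using iX by (simp add: I_def tsupp_def)
    qed
    moreover have "(c * lu j + d * lv j) * j $ k = V $ k"
      if j: "j \<in> I" "nrm ((c * lu j + d * lv j) * j $ k) = nrm (V $ k)" "w j \<le> w i" for j
    proof -
      have "w j < N" using j N[OF i(1)] \<open>A i\<close> by (simp add: w_def)
      then have Aj: "A j" by (auto simp: w_def split: if_splits)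
      then have "wu j \<le> wu i" using j \<open>A i\<close> by (simp add: w_def)
      moreover have "nrm (lu j * j $ k) = nrm (Vu $ k)"
        using j(2) A(1)[OF j(1) Aj] Vk \<open>c \<noteq> 0\<close> by (simp add: mult.assoc)
      ultimately have "lu j * j $ k = Vu $ k" using i(3) A(2)[OF j(1) Aj] by blast
      then show ?thesis using A(1)[OF j(1) Aj] Vk by (simp add: mult.assoc)
    qed
    ultimately show ?thesis using A(1)[OF _ \<open>A i\<close>] iV by metis
  next
    case True
    then have Vk: "V $ k = d * Vv $ k" by (simp add: V left_sum_nrm)
    then have "Vv $ k \<noteq> 0" "d \<noteq> 0" using nz by auto
    then obtain i where i: "i \<in> tsupp X lv" "lv i * i $ k = Vv $ k"
      "\<forall>j\<in>tsupp X lv. nrm (lv j * j $ k) = nrm (Vv $ k) \<and> wv j \<le> wv i \<longrightarrow> lv j * j $ k = Vv $ k"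
      using v unfolding vert_by_def by auto
    have iV: "d * lv i * i $ k = V $ k" using i Vk by (simp add: mult.assoc)
    have iX: "i \<in> X" using i by (simp add: tsupp_def)
    \<comment> \<open>Here the first family stays strictly below the norm of \<open>V\<close> in
      coordinate \<open>k\<close>, so points of the first block cannot compete there.\<close>
    have nA: "\<not> A j" if "j \<in> X" "nrm (d * lv j * j $ k) = nrm (V $ k) \<or> nrm (c * lu j * j $ k) = nrm (V $ k)" for j
    proof
      assume "A j"
      then have "nrm (d * lv j * j $ k) \<le> nrm (c * lu j * j $ k)"
        unfolding nrm_mult[of _ "j $ k"] A_def by (rule mult_right_mono) simp
      then have "nrm (V $ k) \<le> nrm (c * Vu $ k)" using that ule[OF that(1), of k] by linarith
      then show False using True Vk by simp
    qed
    have "\<not> A i" using nA[OF iX] iV by simp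
    have "i \<in> I"
    proof -
      have "d * lv i + c * lu i = d * lv i" 
        using pos[OF iX] \<open>\<not> A i\<close> by (intro nonneg_plus_left) (simp_all add: A_def)
      moreover have "d * lv i \<noteq> 0" using iV nz by auto
      ultimately show ?thesis using iX by (simp add: I_def tsupp_def add.commute)
    qed
    moreover have "(c * lu j + d * lv j) * j $ k = V $ k"
      if j: "j \<in> I" "nrm ((c * lu j + d * lv j) * j $ k) = nrm (V $ k)" "w j \<le> w i" for j
    proof -
      have Aj: "\<not> A j" using nA[OF IX[OF j(1)]] A(1)[OF j(1)] j(2) by metis
      then have "wv j \<le> wv i" using j \<open>\<not> A i\<close> by (simp add: w_def)
      moreover have "nrm (lv j * j $ k) = nrm (Vv $ k)"
        using j(2) B(1)[OF j(1) Aj] Vk \<open>d \<noteq> 0\<close> by (simp add: mult.assoc)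
      ultimately have "lv j * j $ k = Vv $ k" using i(3) B(2)[OF j(1) Aj] by blast
      then show ?thesis using B(1)[OF j(1) Aj] Vk by (simp add: mult.assoc)
    qed
    ultimately show ?thesis using B(1)[OF _ \<open>\<not> A i\<close>] iV by metis
  qed
  have "vert_by w I (\<lambda>x. (c * lu x + d * lv x) *s x) V"
    unfolding vert_by_def vector_smult_component using le ex by blast
  then show ?thesis unfolding I_def V_def by blast
qed

text \<open>Zero receives the sign \<open>Pos\<close>; in \<open>mult_corner_sgn\<close> one of the
  two factors then vanishes, so the choice is immaterial.\<close>

definition sgn_of :: "symtrop \<Rightarrow> tsgn" where
  "sgn_of x = (if x \<in> T_neg then Neg else Pos)"

lemma mult_corner_sgn:
  assumes "c \<in> T_nonneg" "x \<in> T_signed" "0 \<le> r" "nrm x = nrm c * r"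
  shows "c * corner_sgn (sgn_of x) r = x"
proof (cases "x = 0")
  case True
  then show ?thesis using assms by (auto simp: corner_sgn_def)
next
  case False
  then have "0 < nrm c * r" using assms(4) by (metis nrm_pos_iff)
  then have "0 < r" "c \<noteq> 0" using assms by (auto simp: zero_less_mult_iff)
  then obtain a where a: "c = TNum Pos a" using assms(1) by (auto simp: T_nonneg_iff zero_symtrop_def)
  have "exp (a + ln r) = nrm x" using assms(4) a \<open>0 < r\<close> by (simp add: exp_add)
  then show ?thesis
    using assms(2) \<open>0 < r\<close> False a
    by (auto simp: corner_sgn_def sgn_of_def T_signed_iff T_neg_iff zero_symtrop_def)
qed

text \<open>A corner \<open>V\<close> of the combined hypercube is split into corners
  \<open>Vu\<close> and \<open>Vv\<close> of the two given ones by copying the signs of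
  \<open>V\<close> into their free coordinates. Their rankings are then concatenated.\<close>

lemma filled_left_sum:
  assumes X: "X \<subseteq> signed_vecs"
    and l: "lu \<in> X \<rightarrow> T_nonneg" "lv \<in> X \<rightarrow> T_nonneg" "c \<in> T_nonneg" "d \<in> T_nonneg"
    and fin: "finite (tsupp X lu)"
    and u: "filled (tsupp X lu) (\<lambda>x. lu x *s x) u nu"
    and v: "filled (tsupp X lv) (\<lambda>x. lv x *s x) v nv"
  shows "filled (tsupp X (\<lambda>x. c * lu x + d * lv x)) (\<lambda>x. (c * lu x + d * lv x) *s x)
           (left_sum_vec (c *s u) (d *s v)) (\<lambda>k. max (nrm c * nu k) (nrm d * nv k))"
proof -
  define z where "z = left_sum_vec (c *s u) (d *s v)"
  define n where "n k = max (nrm c * nu k) (nrm d * nv k)" for k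
  have zk: "z $ k = left_sum (c * u $ k) (d * v $ k)" for k by (simp add: z_def)
  have us: "u \<in> signed_vecs" "\<And>k. nrm (u $ k) \<le> nu k" and vs: "v \<in> signed_vecs" "\<And>k. nrm (v $ k) \<le> nv k"
    using u v by (auto simp: filled_def)
  have nu: "0 \<le> nu k" and nv: "0 \<le> nv k" for k
    using us(2)[of k] vs(2)[of k] nrm_nonneg order_trans by blast+
  have lu: "nrm (c * u $ k) \<le> nrm c * nu k" and lv: "nrm (d * v $ k) \<le> nrm d * nv k" for k
    using us(2) vs(2) by (auto intro!: mult_left_mono)
  have zs: "z \<in> signed_vecs" unfolding z_def using us vs l by (auto intro: T_nonneg_subset)
  moreover have "nrm (z $ k) \<le> n k" for k
    using lu[of k] lv[of k] by (auto simp only: zk n_def left_sum_nrm split: if_splits)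
  moreover have "\<exists>w. vert_by w (tsupp X (\<lambda>x. c * lu x + d * lv x)) (\<lambda>x. (c * lu x + d * lv x) *s x) V"
    if V: "is_corner n z V" for V
  proof -
    have Vn: "nrm (V $ k) = n k" and Vz: "nrm (z $ k) = n k \<Longrightarrow> V $ k = z $ k" and Vs: "V $ k \<in> T_signed" for k
      using V by (auto simp: is_corner_def signed_vecs_nth)
    define Vu where "Vu = (\<chi> k. if nrm (u $ k) = nu k then u $ k else corner_sgn (sgn_of (V $ k)) (nu k))"
    define Vv where "Vv = (\<chi> k. if nrm (v $ k) = nv k then v $ k else corner_sgn (sgn_of (V $ k)) (nv k))"
    have "is_corner nu u Vu" unfolding Vu_def using us by (intro is_corner_sgn) (auto simp: sgn_of_def)
    moreover have "is_corner nv v Vv" unfolding Vv_def using vs by (intro is_corner_sgn) (auto simp: sgn_of_def)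
    ultimately obtain wu wv where w: "vert_by wu (tsupp X lu) (\<lambda>x. lu x *s x) Vu" "vert_by wv (tsupp X lv) (\<lambda>x. lv x *s x) Vv"
      using u v unfolding filled_def by blast
    have nVu: "nrm (c * Vu $ k) = nrm c * nu k" and nVv: "nrm (d * Vv $ k) = nrm d * nv k" for k
      using nu[of k] nv[of k] by (simp_all add: Vu_def Vv_def)
    have "left_sum_vec (c *s Vu) (d *s Vv) $ k = V $ k" for k
    proof (cases "nrm c * nu k < nrm d * nv k")
      case True
      then have "left_sum_vec (c *s Vu) (d *s Vv) $ k = d * Vv $ k"
        unfolding left_sum_vec_nth vector_smult_component left_sum_nrm nVu nVv by simp
      moreover have "d * Vv $ k = V $ k"
      \<comment> \<open>If the winning point has full norm in coordinate \<open>k\<close>, so has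
        \<open>z\<close>, and \<open>V\<close> agrees with \<open>z\<close> there; otherwise the
        coordinate was free and received the sign of \<open>V\<close>.\<close>
      proof (cases "nrm (v $ k) = nv k")
        case v_eq: True
        then have "nrm (d * v $ k) = nrm d * nv k" by simp
        then have "z $ k = d * v $ k" "nrm (z $ k) = n k"
          using True lu[of k] by (simp_all only: zk left_sum_nrm n_def) auto
        then show ?thesis using Vz[of k] v_eq by (simp add: Vv_def)
      next
        case False
        then show ?thesis using True Vn[of k] nv[of k] Vs l unfolding Vv_def n_def
          by (simp add: mult_corner_sgn)
      qed
      ultimately show ?thesis by simp
    next
      case ge: False
      then have "left_sum_vec (c *s Vu) (d *s Vv) $ k = c * Vu $ k"
        unfolding left_sum_vec_nth vector_smult_component left_sum_nrm nVu nVv by simp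
      moreover have "c * Vu $ k = V $ k"
      proof (cases "nrm (u $ k) = nu k")
        case u_eq: True
        then have "nrm (c * u $ k) = nrm c * nu k" by simp
        then have "z $ k = c * u $ k" "nrm (z $ k) = n k"
          using ge lv[of k] by (simp_all only: zk left_sum_nrm n_def) auto
        then show ?thesis using Vz[of k] u_eq by (simp add: Vu_def)
      next
        case False
        then show ?thesis using ge Vn[of k] nu[of k] Vs l unfolding Vu_def n_def
          by (simp add: mult_corner_sgn)
      qed
      ultimately show ?thesis by simp
    qed
    then have "left_sum_vec (c *s Vu) (d *s Vv) = V" by (simp add: vec_eq_iff)
    then show ?thesis using vert_by_left_sum[OF l fin w] by simp
  qed
  ultimately show ?thesis unfolding filled_def z_def n_def by blast
qed

text \<open>Every corner of \<open>z\<close> is a corner of \<open>x\<close> or of \<open>y\<close>: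
  if \<open>x\<close> has full norm at \<open>a\<close>, then \<open>x\<close> and \<open>y\<close>
  offer both possible entries there, and otherwise \<open>a\<close> is already free for
  \<open>x\<close>.\<close>

lemma filled_edge:
  assumes "filled I p x n" "filled I p y n" "z \<in> signed_vecs"
    and "\<And>k. k \<noteq> a \<Longrightarrow> z $ k = x $ k" "\<And>k. k \<noteq> a \<Longrightarrow> z $ k = y $ k"
    and "x $ a = - y $ a" "nrm (z $ a) \<le> nrm (x $ a)"
  shows "filled I p z n"
  unfolding filled_def
proof (intro conjI allI impI)
  show "z \<in> signed_vecs" by fact
  show "nrm (z $ k) \<le> n k" for k
    using assms by (cases "k = a") (auto simp: filled_def intro: order_trans)
  fix v assume v: "is_corner n z v"
  have "is_corner n x v \<or> is_corner n y v"
  proof (cases "nrm (x $ a) = n a")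
    case True
    then have "v $ a = x $ a \<or> v $ a = - x $ a"
      using v assms(1) by (intro signed_eq_or_uminus) (auto simp: is_corner_def filled_def signed_vecs_nth)
    moreover have "- x $ a = y $ a"
      using assms(2,6) signed_vecs_nth[of y a] by (auto simp: filled_def T_signed_iff)
    ultimately have "v $ a = x $ a \<or> v $ a = y $ a" by simp
    then show ?thesis using v assms(4,5) unfolding is_corner_def by metis
  next
    case False
    then show ?thesis using v assms(4) unfolding is_corner_def by metis
  qed
  then show "\<exists>w. vert_by w I p v" using assms(1,2) unfolding filled_def by blast
qed

text \<open>For every corner and every coordinate keep one point that attains the coordinate, and one point
  more whose coefficient is \<open>1\<close>.\<close>

lemma caratheodory:
  fixes X :: "(symtrop ^ 'n::finite) set"
  assumes l: "comb X l" and z: "filled (tsupp X l) (\<lambda>x. l x *s x) z n"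
  shows "\<exists>l'. comb X l' \<and> card (tsupp X l') \<le> CARD('n) * 2 ^ CARD('n) + 1 \<and>
     filled (tsupp X l') (\<lambda>x. l' x *s x) z n"
proof -
  define C where "C = {v. is_corner n z v}"
  \<comment> \<open>The norms of a corner are prescribed, so it is determined by the set of its
    positive coordinates.\<close>
  have inj: "inj_on (\<lambda>v. {k. v $ k \<in> T_pos}) C"
  proof (rule inj_onI)
    fix v v' assume v: "v \<in> C" "v' \<in> C" "{k. v $ k \<in> T_pos} = {k. v' $ k \<in> T_pos}"
    have "v $ k = v' $ k" for k
    proof -
      have "v $ k \<in> T_pos \<longleftrightarrow> v' $ k \<in> T_pos" using v(3) by blast
      moreover have "nrm (v $ k) = nrm (v' $ k)" "v $ k \<in> T_signed" "v' $ k \<in> T_signed"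
        using v by (auto simp: C_def is_corner_def signed_vecs_nth)
      ultimately show ?thesis by (auto simp: T_signed_iff T_pos_iff less_imp_neq[OF exp_gt_zero])
    qed
    then show "v = v'" by (simp add: vec_eq_iff)
  qed
  have finC: "finite C" using inj by (rule inj_on_finite[where B = UNIV]) auto
  have "card C \<le> card (Pow (UNIV :: 'n set))" using inj by (intro card_inj_on_le[of _ C]) auto
  then have cardC: "card C \<le> 2 ^ CARD('n)" by (simp add: card_Pow)
  have "\<forall>v\<in>C. \<exists>w. vert_by w (tsupp X l) (\<lambda>x. l x *s x) v" using z by (auto simp: filled_def C_def)
  then obtain w where w: "\<And>v. v \<in> C \<Longrightarrow> vert_by (w v) (tsupp X l) (\<lambda>x. l x *s x) v" by metis
  obtain x0 where x0: "x0 \<in> X" "l x0 = 1" using l unfolding comb_iff by blast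
  have x0': "x0 \<in> tsupp X l" using x0 by (simp add: tsupp_def)
  have "\<exists>i\<in>tsupp X l. v $ k \<noteq> 0 \<longrightarrow> (l i *s i) $ k = v $ k \<and>
       (\<forall>j\<in>tsupp X l. nrm ((l j *s j) $ k) = nrm (v $ k) \<and> w v j \<le> w v i \<longrightarrow> (l j *s j) $ k = v $ k)"
    if "v \<in> C" for v k
    using w[OF that] x0' unfolding vert_by_def by blast
  then obtain f where f: "\<And>v k. v \<in> C \<Longrightarrow> f v k \<in> tsupp X l"
    "\<And>v k. v \<in> C \<Longrightarrow> v $ k \<noteq> 0 \<Longrightarrow> (l (f v k) *s f v k) $ k = v $ k \<and>
       (\<forall>j\<in>tsupp X l. nrm ((l j *s j) $ k) = nrm (v $ k) \<and> w v j \<le> w v (f v k) \<longrightarrow> (l j *s j) $ k = v $ k)"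
    by metis
  define J where "J = insert x0 ((\<lambda>(v, k). f v k) ` (C \<times> UNIV))"
  have J: "J \<subseteq> tsupp X l" "finite J" using x0' f finC by (auto simp: J_def)
  have "card J \<le> Suc (card ((\<lambda>(v, k). f v k) ` (C \<times> (UNIV :: 'n set))))"
    unfolding J_def by (rule card_insert_le_m1) auto
  also have "\<dots> \<le> Suc (card (C \<times> (UNIV :: 'n set)))"
    using finC by (simp only: Suc_le_mono) (intro card_image_le, simp)
  also have "\<dots> \<le> CARD('n) * 2 ^ CARD('n) + 1" using cardC by (simp add: card_cartesian_product)
  finally have cardJ: "card J \<le> CARD('n) * 2 ^ CARD('n) + 1" .
  define l' where "l' x = (if x \<in> J then l x else 0)" for x
  have supp: "tsupp X l' = J" using J by (auto simp: tsupp_def l'_def)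
  have "comb X l'" using l J x0 unfolding comb_iff supp
    by (auto simp: l'_def J_def)
  moreover have "filled J (\<lambda>x. l' x *s x) z n"
  proof -
    \<comment> \<open>The old rankings still work: dropping points only removes competitors, and
      \<open>f v k\<close> keeps coordinate \<open>k\<close> attained.\<close>
    have "vert_by (w v) J (\<lambda>x. l' x *s x) v" if v: "v \<in> C" for v
      unfolding vert_by_def
    proof (intro allI conjI impI ballI)
      fix k i assume "i \<in> J"
      then show "nrm ((l' i *s i) $ k) \<le> nrm (v $ k)"
        using w[OF v] J by (auto simp: vert_by_def l'_def)
    next
      fix k assume k: "v $ k \<noteq> 0"
      have "f v k \<in> J" using v by (auto simp: J_def)
      moreover have "(l' (f v k) *s f v k) $ k = v $ k" using f(2)[OF v k] \<open>f v k \<in> J\<close> by (simp add: l'_def)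
      moreover have "(l' j *s j) $ k = v $ k"
        if "j \<in> J" "nrm ((l' j *s j) $ k) = nrm (v $ k)" "w v j \<le> w v (f v k)" for j
        using f(2)[OF v k] that J by (auto simp: l'_def)
      ultimately show "\<exists>i\<in>J. (l' i *s i) $ k = v $ k \<and>
        (\<forall>j\<in>J. nrm ((l' j *s j) $ k) = nrm (v $ k) \<and> w v j \<le> w v i \<longrightarrow> (l' j *s j) $ k = v $ k)"
        by blast
    qed
    then show ?thesis using z unfolding filled_def C_def by blast
  qed
  ultimately show ?thesis using cardJ supp by blast
qed

section \<open>TC-segments\<close>


lemma le_symtrop_simps [simp]:
  "TInf \<le> TInf" "TInf \<le> TNum Pos b" "\<not> TInf \<le> TNum Neg b"
  "\<not> TNum Pos a \<le> TInf" "TNum Pos a \<le> TNum Pos b \<longleftrightarrow> a \<le> b" "\<not> TNum Pos a \<le> TNum Neg b"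
  "TNum Neg a \<le> TInf" "TNum Neg a \<le> TNum Pos b" "TNum Neg a \<le> TNum Neg b \<longleftrightarrow> b \<le> a"
  by (auto simp: less_eq_symtrop_def less_symtrop_def T_pos_iff split: if_splits)

lemma signed_le_antisym: "x \<in> T_signed \<Longrightarrow> y \<in> T_signed \<Longrightarrow> x \<le> y \<Longrightarrow> y \<le> x \<Longrightarrow> x = y"
  by (auto simp: T_signed_iff)

lemma signed_le_trans:
  "x \<in> T_signed \<Longrightarrow> y \<in> T_signed \<Longrightarrow> z \<in> T_signed \<Longrightarrow> x \<le> y \<Longrightarrow> y \<le> z \<Longrightarrow> x \<le> z"
  by (auto simp: T_signed_iff)

text \<open>For \<open>l \<oplus> m = 1\<close> the points \<open>path_point b l m\<close> form a path from \<open>v\<close> to \<open>u\<close>; the flag tells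
  which of the two summands wins a tie.\<close>

definition path_point :: "bool \<Rightarrow> symtrop \<Rightarrow> symtrop \<Rightarrow> symtrop \<Rightarrow> symtrop \<Rightarrow> symtrop" where
  "path_point b l m u v = (if b then left_sum (l * u) (m * v) else left_sum (m * v) (l * u))"

text \<open>Some halfspace in coordinates \<open>j\<close> and \<open>k\<close> contains
  \<open>u\<close> and \<open>v\<close> but not \<open>z\<close>; \<open>ak \<noteq> 0\<close>
  ensures a nonzero linear part.\<close>

definition separated :: "symtrop \<Rightarrow> symtrop \<Rightarrow> symtrop \<Rightarrow> symtrop \<Rightarrow> symtrop \<Rightarrow> symtrop \<Rightarrow> bool" where
  "separated uj uk vj vk zj zk \<longleftrightarrow> (\<exists>a0 aj ak. a0 \<in> T_signed \<and> aj \<in> T_signed \<and> ak \<in> T_signed \<and> ak \<noteq> 0 \<and>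
     a0 + (aj * uj + ak * uk) \<notin> T_neg \<and> a0 + (aj * vj + ak * vk) \<notin> T_neg \<and>
     a0 + (aj * zj + ak * zk) \<in> T_neg)"

lemma neg_simps [simp]: "TInf \<notin> T_neg" "TNum s a \<in> T_neg \<longleftrightarrow> s = Neg"
  by (auto simp: T_neg_iff)

lemma signed_TNum [simp]: "TInf \<in> T_signed" "TNum Pos a \<in> T_signed" "TNum Neg a \<in> T_signed"
  by (auto simp: T_signed_iff)

text \<open>In each of the following cases a path point with \<open>j\<close>-th coordinate at least \<open>zj\<close> is written
  down explicitly, and a halfspace supported on \<open>j\<close>, \<open>k\<close> and the constant term is found if its
  \<open>k\<close>-th coordinate exceeds \<open>zk\<close>. The coefficients come from the equation of the line through \<open>u\<close>
  and \<open>v\<close>, the signs of cancelling minors being chosen such that \<open>u\<close> and \<open>v\<close> stay inside.\<close>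

lemma separated_case_pos:
  assumes "uk \<in> T_signed" "vk \<in> T_signed" "zk \<in> T_signed" "vj \<in> T_signed"
    and "vj \<le> TNum Pos c" "nrm vj < exp c" "c \<le> d" "vk \<le> zk" "zk \<le> uk"
    and "\<not> path_point False (TNum Pos (c - d)) 1 uk vk \<le> zk"
  shows "separated (TNum Pos d) uk vj vk (TNum Pos c) zk"
  unfolding separated_def
proof (intro exI conjI)
  \<comment> \<open>The minors for \<open>j\<close> and \<open>k\<close> are \<open>vk - uk\<close>
    and \<open>uj - vj\<close>. Since the path point is not below \<open>zk\<close>, the norm of
    \<open>vk\<close> is smaller than that of \<open>uk\<close>; as \<open>d\<close> also outweighs
    \<open>vj\<close>, they reduce to \<open>- uk\<close> and \<open>d\<close>.\<close>
  let ?a0 = "\<bar>vk * TNum Pos d + uk * vj\<bar>" let ?aj = "- uk" let ?ak = "TNum Pos d"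
  show "?a0 \<in> T_signed" by (cases "vk * TNum Pos d + uk * vj") auto
  show "?aj \<in> T_signed" "?ak \<in> T_signed" "?ak \<noteq> 0" using assms by (auto simp: zero_symtrop_def)
  show "?a0 + (?aj * TNum Pos d + ?ak * uk) \<notin> T_neg"
    by (insert assms, (erule T_signed_cases[of uk]; erule T_signed_cases[of vk]; erule T_signed_cases[of vj]))
      (simp_all split: if_splits)
  show "?a0 + (?aj * vj + ?ak * vk) \<notin> T_neg"
    by (insert assms, (erule T_signed_cases[of uk]; erule T_signed_cases[of vk]; erule T_signed_cases[of vj]))
      (simp_all split: if_splits)
  show "?a0 + (?aj * TNum Pos c + ?ak * zk) \<in> T_neg"
    by (insert assms, (erule T_signed_cases[of uk]; erule T_signed_cases[of vk]; erule T_signed_cases[of vj]; erule T_signed_cases[of zk]))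
      (simp_all add: path_point_def left_sum_nrm one_symtrop_def zero_symtrop_def split: if_splits)
qed

text \<open>Scaling \<open>v\<close> by \<open>c - e\<close> moves its \<open>j\<close>-th entry to
  \<open>TNum Neg c\<close>, and the flag \<open>False\<close> lets it win a tie with
  \<open>uj\<close>.\<close>

lemma separated_case_neg:
  assumes "uk \<in> T_signed" "vk \<in> T_signed" "zk \<in> T_signed" "uj \<in> T_signed"
    and "c < e" "TNum Neg c \<le> uj" "nrm uj \<le> exp c" "vk \<le> zk" "zk \<le> uk"
    and "\<not> path_point False 1 (TNum Pos (c - e)) uk vk \<le> zk"
  shows "separated uj uk (TNum Neg e) vk (TNum Neg c) zk"
\<comment> \<open>The cases tell whether \<open>v\<close> or \<open>u\<close> wins in the
  \<open>k\<close>-th coordinate of the path point; ties go to \<open>v\<close>.\<close>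
proof (cases "nrm uk \<le> nrm (TNum Pos (c - e) * vk)")
  case True
  let ?a0 = "TNum Pos e * \<bar>uk\<bar> + \<bar>vk\<bar> * \<bar>uj\<bar>" let ?aj = "- \<bar>vk\<bar>" let ?ak = "TNum Pos e"
  show ?thesis
    unfolding separated_def
    by (rule exI[of _ ?a0], rule exI[of _ ?aj], rule exI[of _ ?ak], insert assms True,
        (erule T_signed_cases[of uk]; erule T_signed_cases[of vk]; erule T_signed_cases[of zk]; erule T_signed_cases[of uj]))
      (simp_all add: path_point_def left_sum_nrm one_symtrop_def zero_symtrop_def split: if_splits)
next
  case False
  let ?a0 = "- (TNum Pos e * uk)" let ?aj = "- (\<bar>vk\<bar> + \<bar>uk\<bar>)" let ?ak = "TNum Pos e"
  show ?thesis
    unfolding separated_def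
    by (rule exI[of _ ?a0], rule exI[of _ ?aj], rule exI[of _ ?ak], insert assms False,
        (erule T_signed_cases[of uk]; erule T_signed_cases[of vk]; erule T_signed_cases[of zk]; erule T_signed_cases[of uj]))
      (simp_all add: path_point_def left_sum_nrm one_symtrop_def zero_symtrop_def split: if_splits)
qed

text \<open>The parameters scale both \<open>j\<close>-th entries to norm \<open>min d e\<close>,
  where the path jumps from negative to positive. The conditions on a negative \<open>zj\<close>
  exclude the lower end of the jump, so \<open>zj\<close> is reached only after it.\<close>

lemma separated_case_flip:
  assumes "uk \<in> T_signed" "vk \<in> T_signed" "zk \<in> T_signed" "zj \<in> T_signed"
    and "TNum Neg e \<le> zj" "zj \<noteq> TNum Neg e" "nrm zj \<le> exp (min d e)"
    and "\<And>c. zj = TNum Neg c \<Longrightarrow> c < d" "vk \<le> zk" "zk \<le> uk"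
    and "\<not> path_point True (TNum Pos (min 0 (e - d))) (TNum Pos (min 0 (d - e))) uk vk \<le> zk"
  shows "separated (TNum Pos d) uk (TNum Neg e) vk zj zk"
proof -
  let ?a0 = "- left_sum (TNum Pos e * uk) (TNum Pos d * vk)"
  let ?aj = "- (\<bar>uk\<bar> + \<bar>vk\<bar>)" let ?ak = "TNum Pos (max d e)"
  show ?thesis
    unfolding separated_def
    by (rule exI[of _ ?a0], rule exI[of _ ?aj], rule exI[of _ ?ak], insert assms,
        (erule T_signed_cases[of uk]; erule T_signed_cases[of vk]; erule T_signed_cases[of zk]; erule T_signed_cases[of zj]))
      (simp_all add: path_point_def left_sum_nrm one_symtrop_def zero_symtrop_def max_def min_def split: if_splits)
qed


text \<open>Every path point with a nonzero multiple of \<open>v\<close> is negative in coordinate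
  \<open>j\<close>, so only the end \<open>u\<close> reaches \<open>zj\<close>, and
  \<open>uk\<close> is the value to compare.\<close>

lemma separated_case_zero:
  assumes "uk \<in> T_signed" "vk \<in> T_signed" "zk \<in> T_signed" "vk \<le> zk" "zk \<le> uk" "\<not> uk \<le> zk"
  shows "separated TInf uk (TNum Neg e) vk TInf zk"
proof -
  let ?a0 = "- (TNum Pos e * uk)" let ?aj = "- (\<bar>uk\<bar> + \<bar>vk\<bar>)" let ?ak = "TNum Pos e"
  show ?thesis
    unfolding separated_def
    by (rule exI[of _ ?a0], rule exI[of _ ?aj], rule exI[of _ ?ak], insert assms,
        (erule T_signed_cases[of uk]; erule T_signed_cases[of vk]; erule T_signed_cases[of zk]))
      (simp_all add: zero_symtrop_def split: if_splits)
qed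

section \<open>Monotonicity and jumps of the path of left sums\<close>

definition normalized :: "symtrop \<Rightarrow> symtrop \<Rightarrow> bool" where
  "normalized l m \<longleftrightarrow> l \<in> T_nonneg \<and> m \<in> T_nonneg \<and> l + m = 1"

lemma normalized_cases:
  assumes "normalized l m"
  obtains "l = TNum Pos 0" "m = TInf" | "l = TInf" "m = TNum Pos 0"
    | a where "l = TNum Pos 0" "m = TNum Pos a" "a \<le> 0" | a where "l = TNum Pos a" "m = TNum Pos 0" "a \<le> 0"
  using assms by (auto simp: normalized_def T_nonneg_iff one_symtrop_def split: if_splits)

lemma normalized_simps [simp]:
  "normalized TInf (TNum Pos 0)" "normalized (TNum Pos 0) TInf"
  "normalized (TNum Pos a) (TNum Pos b) \<longleftrightarrow> max a b = 0"
  by (auto simp: normalized_def T_nonneg_iff one_symtrop_def)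

text \<open>One of two normalised coefficients is always \<open>1\<close>, so the parameters run
  linearly: first \<open>l\<close> grows to \<open>1\<close>, then \<open>m\<close>
  decreases.\<close>

lemma normalized_linear:
  "normalized l m \<Longrightarrow> normalized l' m' \<Longrightarrow>
    nrm l \<le> nrm l' \<and> nrm m' \<le> nrm m \<or> nrm l' \<le> nrm l \<and> nrm m \<le> nrm m'"
  by (erule normalized_cases; erule normalized_cases) auto

lemma left_sum_TInf [simp]: "left_sum x TInf = x" "left_sum TInf x = x"
  by (cases x; simp add: left_sum_nrm)+

lemma TNum_Pos_0_mult [simp]: "TNum Pos 0 * x = x"
  by (cases x) auto

lemma path_point_mono:
  assumes "normalized l m" "normalized l' m'" "(l, m) \<noteq> (l', m')" "nrm l \<le> nrm l'" "nrm m' \<le> nrm m"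
    "u \<in> T_signed" "v \<in> T_signed" "v \<le> u"
  shows "path_point b l m u v \<le> path_point b' l' m' u v"
  by (insert assms, (erule normalized_cases[of l]; erule normalized_cases[of l'];
        erule T_signed_cases[of u]; erule T_signed_cases[of v]))
    (simp_all add: path_point_def left_sum_nrm add_nonpos_eq_0_iff, auto)

lemma path_point_False_le_True:
  assumes "normalized l m" "u \<in> T_signed" "v \<in> T_signed" "v \<le> u"
  shows "path_point False l m u v \<le> path_point True l m u v"
  by (insert assms, (erule normalized_cases; erule T_signed_cases[of u]; erule T_signed_cases[of v]))
    (simp_all add: path_point_def left_sum_nrm)

lemma path_point_signed: "normalized l m \<Longrightarrow> u \<in> T_signed \<Longrightarrow> v \<in> T_signed \<Longrightarrow> path_point b l m u v \<in> T_signed"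
  by (auto simp: path_point_def normalized_def intro: T_nonneg_subset)

text \<open>The alternatives locate \<open>z\<close> on the path: at its start, where a multiple of
  \<open>u\<close> dominates, where a multiple of \<open>v\<close> dominates, in the jump at a tie
  of opposite signs, or at the end when \<open>u\<close> is zero.\<close>

lemma between_cases [consumes 5]:
  assumes s: "u \<in> T_signed" "v \<in> T_signed" "z \<in> T_signed" and le: "v \<le> z" "z \<le> u"
  obtains "z = v"
    | c d where "z = TNum Pos c" "nrm v < exp c" "u = TNum Pos d" "c \<le> d"
    | c e where "z = TNum Neg c" "nrm u \<le> exp c" "v = TNum Neg e" "c < e"
    | d e where "u = TNum Pos d" "v = TNum Neg e" "z \<noteq> v" "nrm z \<le> exp (min d e)"
        "\<And>c. z = TNum Neg c \<Longrightarrow> c < d"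
    | e where "u = TInf" "z = TInf" "v = TNum Neg e"
  using s(3)
proof (cases rule: T_signed_cases)
  case Inf
  with s le that(1,5) consider "z = v" | e where "v = TNum Neg e" "u = TInf"
    | d e where "v = TNum Neg e" "u = TNum Pos d"
    by (auto simp: T_signed_iff)
  then show ?thesis using that(1,4,5) Inf by cases auto
next
  case (Pos c)
  then obtain d where d: "u = TNum Pos d" "c \<le> d" using s le by (auto simp: T_signed_iff)
  show ?thesis
  proof (cases "nrm v < exp c")
    case False
    then consider "z = v" | e where "v = TNum Neg e" "c \<le> e" using Pos s le by (auto simp: T_signed_iff)
    then show ?thesis using that(1,4) Pos d by cases auto
  qed (use that(2) Pos d in blast)
next
  case (Neg c)
  then obtain e where e: "v = TNum Neg e" "c \<le> e" using s le by (auto simp: T_signed_iff)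
  show ?thesis
  proof (cases "z = v")
    case False
    then have "c < e" using e Neg by auto
    show ?thesis
    proof (cases "nrm u \<le> exp c")
      case False
      then obtain d where "u = TNum Pos d" "c < d" using Neg s le by (auto simp: T_signed_iff)
      then show ?thesis using that(4) Neg e \<open>z \<noteq> v\<close> by auto
    qed (use that(3) Neg e \<open>c < e\<close> in blast)
  qed (rule that(1))
qed

text \<open>In each case the witness is the earliest path point whose \<open>j\<close>-th coordinate
  reaches \<open>zj\<close>. If its \<open>k\<close>-th coordinate were already beyond
  \<open>zk\<close>, a halfspace would separate.\<close>

lemma path_point_meets_pair:
  assumes s: "uj \<in> T_signed" "vj \<in> T_signed" "zj \<in> T_signed" "uk \<in> T_signed" "vk \<in> T_signed" "zk \<in> T_signed"
    and le: "vj \<le> zj" "zj \<le> uj" "vk \<le> zk" "zk \<le> uk"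
    and not_sep: "\<not> separated uj uk vj vk zj zk"
  shows "\<exists>b l m. normalized l m \<and> zj \<le> path_point b l m uj vj \<and> path_point b l m uk vk \<le> zk"
proof -
  from s(1-3) le(1,2) show ?thesis
  proof (cases rule: between_cases)
    case 1
    then have "normalized TInf (TNum Pos 0) \<and> zj \<le> path_point False TInf (TNum Pos 0) uj vj \<and>
        path_point False TInf (TNum Pos 0) uk vk \<le> zk"
      using le by (simp add: path_point_def)
    then show ?thesis by blast
  next
    case (2 c d)
    then have "path_point False (TNum Pos (c - d)) 1 uk vk \<le> zk"
      using separated_case_pos[of uk vk zk vj c d] s le not_sep by auto
    moreover have "zj \<le> path_point False (TNum Pos (c - d)) 1 uj vj"
      using 2 by (simp add: path_point_def left_sum_nrm)
    moreover have "normalized (TNum Pos (c - d)) 1" using 2 by (simp add: one_symtrop_def)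
    ultimately show ?thesis by blast
  next
    case (3 c e)
    then have "path_point False 1 (TNum Pos (c - e)) uk vk \<le> zk"
      using separated_case_neg[of uk vk zk uj c e] s le not_sep by auto
    moreover have "zj \<le> path_point False 1 (TNum Pos (c - e)) uj vj"
      using 3 by (simp add: path_point_def left_sum_nrm)
    moreover have "normalized 1 (TNum Pos (c - e))" using 3 by (simp add: one_symtrop_def)
    ultimately show ?thesis by blast
  next
    case (4 d e)
    let ?l = "TNum Pos (min 0 (e - d))" let ?m = "TNum Pos (min 0 (d - e))"
    have "path_point True ?l ?m uk vk \<le> zk"
      using separated_case_flip[of uk vk zk zj e d] 4 s le not_sep by auto
    moreover have "zj \<le> path_point True ?l ?m uj vj"
      using 4 s(3) by (simp only:) (erule T_signed_cases; auto simp: path_point_def left_sum_nrm min_def split: if_splits)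
    moreover have "normalized ?l ?m" by (simp add: min_def)
    ultimately show ?thesis by blast
  next
    case (5 e)
    then have "uk \<le> zk" using separated_case_zero[of uk vk zk e] s le not_sep by auto
    then have "normalized (TNum Pos 0) TInf \<and> zj \<le> path_point True (TNum Pos 0) TInf uj vj \<and>
        path_point True (TNum Pos 0) TInf uk vk \<le> zk"
      using 5 by (simp add: path_point_def)
    then show ?thesis by blast
  qed
qed

text \<open>A single coordinate skips a value only where its two summands tie with opposite
  signs.\<close>

lemma path_point_jump:
  assumes s: "u \<in> T_signed" "v \<in> T_signed" "z \<in> T_signed" and le: "v \<le> z" "z \<le> u"
  shows "(\<exists>b l m. normalized l m \<and> path_point b l m u v = z) \<or>
    (\<exists>l m. normalized l m \<and> l * u = - (m * v) \<and> nrm z \<le> nrm (l * u) \<and>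
       path_point False l m u v \<le> z \<and> z \<le> path_point True l m u v)"
proof -
  from s le show ?thesis
  proof (cases rule: between_cases)
    case 1
    then have "normalized TInf (TNum Pos 0)" "path_point False TInf (TNum Pos 0) u v = z"
      by (simp_all add: path_point_def)
    then show ?thesis by blast
  next
    case (2 c d)
    then have "normalized (TNum Pos (c - d)) 1" "path_point False (TNum Pos (c - d)) 1 u v = z"
      by (simp_all add: path_point_def left_sum_nrm one_symtrop_def[symmetric]) (simp add: one_symtrop_def)
    then show ?thesis by blast
  next
    case (3 c e)
    then have "normalized 1 (TNum Pos (c - e))" "path_point False 1 (TNum Pos (c - e)) u v = z"
      by (simp_all add: path_point_def left_sum_nrm one_symtrop_def[symmetric]) (simp add: one_symtrop_def)
    then show ?thesis by blast
  next
    case (4 d e)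
    let ?l = "TNum Pos (min 0 (e - d))" let ?m = "TNum Pos (min 0 (d - e))"
    have "normalized ?l ?m" "?l * u = - (?m * v)" "nrm z \<le> nrm (?l * u)"
      "path_point False ?l ?m u v \<le> z" "z \<le> path_point True ?l ?m u v"
      using 4 s(3) by (auto simp: path_point_def left_sum_nrm T_signed_iff min_def)
    then show ?thesis by blast
  next
    case (5 e)
    then have "normalized (TNum Pos 0) TInf" "path_point True (TNum Pos 0) TInf u v = z"
      by (simp_all add: path_point_def)
    then show ?thesis by blast
  qed
qed

section \<open>From pairs of coordinates to whole points of a TC-segment\<close>

lemma signed_le_iff_diff: "x \<in> T_signed \<Longrightarrow> y \<in> T_signed \<Longrightarrow> y \<le> x \<longleftrightarrow> x + (- y) \<notin> T_neg"
  by (erule T_signed_cases; erule T_signed_cases) auto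

lemma conv_TC2_halfspaceD:
  assumes "z \<in> conv_TC2 u v" "u \<in> signed_vecs" "v \<in> signed_vecs" "a0 \<in> T_signed" "a \<in> signed_vecs" "a \<noteq> 0"
    and "a0 + (\<Sum>i\<in>UNIV. a $ i * u $ i) \<notin> T_neg" "a0 + (\<Sum>i\<in>UNIV. a $ i * v $ i) \<notin> T_neg"
  shows "a0 + (\<Sum>i\<in>UNIV. a $ i * z $ i) \<notin> T_neg"
proof -
  have "u \<in> closed_halfspace a0 a" "v \<in> closed_halfspace a0 a"
    using assms unfolding closed_halfspace_def pos_or_bal_iff by simp_all
  then have "z \<in> closed_halfspace a0 a"
    using assms unfolding conv_TC2_def closed_halfspaces_def by blast
  then show ?thesis unfolding closed_halfspace_def pos_or_bal_iff by simp
qed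

lemma sum_two_coordinates:
  fixes f :: "'n::finite \<Rightarrow> symtrop"
  assumes "j \<noteq> k"
  shows "(\<Sum>i\<in>UNIV. (if i = j then a else if i = k then b else 0) * f i) = a * f j + b * f k"
proof -
  have "(if i = j then a else if i = k then b else 0) * f i =
      (if i = j then a * f i else 0) + (if i = k then b * f i else 0)" for i
    using assms by auto
  then show ?thesis by (simp add: sum.distrib)
qed

lemma finite_chain_least:
  fixes F :: "'n::finite \<Rightarrow> 'b set"
  assumes "\<And>j j'. F j \<subseteq> F j' \<or> F j' \<subseteq> F j"
  shows "\<exists>j. \<forall>j'. F j \<subseteq> F j'"
proof -
  obtain m where "m \<in> range F" "\<forall>b\<in>range F. b \<le> m \<longrightarrow> m = b"
    using finite_has_minimal[of "range F"] by auto
  then show ?thesis using assms by (metis rangeE rangeI)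
qed


lemma smult_path_point: "c * path_point b l m u v = path_point b l m (c * u) (c * v)"
  by (simp add: path_point_def left_sum_mult mult.left_commute)

lemma conv_TC2_cases:
  fixes u v z :: "symtrop ^ 'n::finite"
  assumes u: "u \<in> signed_vecs" and v: "v \<in> signed_vecs" and z: "z \<in> conv_TC2 u v"
  obtains b l m where "normalized l m" "\<And>k. z $ k = path_point b l m (u $ k) (v $ k)"
    | a l m where "normalized l m" "\<And>b k. k \<noteq> a \<Longrightarrow> z $ k = path_point b l m (u $ k) (v $ k)"
      "l * u $ a = - (m * v $ a)" "nrm (z $ a) \<le> nrm (l * u $ a)"
proof -
  have zs: "z \<in> signed_vecs" using z by (simp add: conv_TC2_def)
  \<comment> \<open>Flipping signs makes every coordinate increase along the path from \<open>v\<close> to \<open>u\<close>.\<close>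
  define s where "s k = (if v $ k \<le> u $ k then 1 else TNum Neg 0)" for k
  have s: "s k \<in> T_signed" "s k \<noteq> 0" "nrm (s k) = 1" for k
    by (auto simp: s_def zero_symtrop_def one_symtrop_def)
  have cancel: "s k * x = s k * y \<Longrightarrow> x = y" for k x y using mult_inj_symtrop s by blast
  define u' v' z' where "u' k = s k * u $ k" and "v' k = s k * v $ k" and "z' k = s k * z $ k" for k
  have sg: "u' k \<in> T_signed" "v' k \<in> T_signed" "z' k \<in> T_signed" for k
    using s u v zs by (auto simp: u'_def v'_def z'_def signed_vecs_nth)
  have vu: "v' k \<le> u' k" for k
  proof (cases "v $ k \<le> u $ k")
    case False
    then show ?thesis using signed_vecs_nth[OF u, of k] signed_vecs_nth[OF v, of k]
      by (auto simp: u'_def v'_def s_def T_signed_iff)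
  qed (simp add: u'_def v'_def s_def)
  have half: "a0 + (aj * z' j + ak * z' k) \<notin> T_neg"
    if "j \<noteq> k" "a0 \<in> T_signed" "aj \<in> T_signed" "ak \<in> T_signed" "ak \<noteq> 0"
      "a0 + (aj * u' j + ak * u' k) \<notin> T_neg" "a0 + (aj * v' j + ak * v' k) \<notin> T_neg" for j k a0 aj ak
  proof -
    define a where "a = (\<chi> i. if i = j then aj * s j else if i = k then ak * s k else 0)"
    have sum: "(\<Sum>i\<in>UNIV. a $ i * x $ i) = aj * (s j * x $ j) + ak * (s k * x $ k)" for x
      using that(1) by (simp add: a_def sum_two_coordinates mult.assoc)
    have "nrm (a $ k) = nrm ak" using that(1) s by (simp add: a_def)
    then have "a \<noteq> 0" using that(5) by (metis nrm_eq_0_iff zero_index)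
    moreover have "a \<in> signed_vecs" using that s by (auto simp: a_def signed_vecs_def)
    ultimately show ?thesis
      using conv_TC2_halfspaceD[OF z u v that(2), of a] that(6,7) unfolding sum u'_def v'_def z'_def by blast
  qed
  \<comment> \<open>Halfspaces in a single coordinate confine \<open>z'\<close> to the range between
    \<open>v'\<close> and \<open>u'\<close> that the path covers.\<close>
  have half1: "a0 + ak * z' k \<notin> T_neg"
    if "a0 \<in> T_signed" "ak \<in> T_signed" "ak \<noteq> 0"
      "a0 + ak * u' k \<notin> T_neg" "a0 + ak * v' k \<notin> T_neg" for k a0 ak
  proof -
    define a where "a = (\<chi> i. if i = k then ak * s k else 0)"
    have "a $ i * x $ i = (if i = k then ak * (s i * x $ i) else 0)" for x i by (simp add: a_def mult.assoc)
    then have sum: "(\<Sum>i\<in>UNIV. a $ i * x $ i) = ak * (s k * x $ k)" for x by simp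
    have "nrm (a $ k) = nrm ak" using s by (simp add: a_def)
    then have "a \<noteq> 0" using that(3) by (metis nrm_eq_0_iff zero_index)
    moreover have "a \<in> signed_vecs" using that s by (auto simp: a_def signed_vecs_def)
    ultimately show ?thesis
      using conv_TC2_halfspaceD[OF z u v that(1), of a] that(4,5) unfolding sum u'_def v'_def z'_def by blast
  qed
  have diff: "x \<le> y \<longleftrightarrow> - x + 1 * y \<notin> T_neg" "x \<le> y \<longleftrightarrow> y + TNum Neg 0 * x \<notin> T_neg"
    if "x \<in> T_signed" "y \<in> T_signed" for x y
    using signed_le_iff_diff[OF that(2,1)] uminus_mult_symtrop[of x] by (simp_all add: add.commute)
  have refl: "x \<le> x" for x :: symtrop by (simp add: less_eq_symtrop_def)
  have vz: "v' k \<le> z' k" for k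
    using half1[of "- v' k" 1 k] sg vu[of k] refl unfolding diff(1)[OF sg(2) sg(3)]
    by (simp add: diff(1)[symmetric] del: mult_1_left)
  have zu: "z' k \<le> u' k" for k
    using half1[of "u' k" "TNum Neg 0" k] sg vu[of k] refl
    by (simp add: diff(2)[symmetric] zero_symtrop_def)
  define pp where "pp b l m k = path_point b l m (u' k) (v' k)" for b l m k
  have pps: "normalized l m \<Longrightarrow> pp b l m k \<in> T_signed" for b l m k
    unfolding pp_def using sg by (intro path_point_signed)
  have trans: "x \<le> y \<Longrightarrow> y \<le> w \<Longrightarrow> x \<le> w" if "x \<in> T_signed" "y \<in> T_signed" "w \<in> T_signed" for x y w
    using signed_le_trans that by blast
  have pp_eq: "z $ k = path_point b l m (u $ k) (v $ k)" if "z' k = pp b l m k" for b l m k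
    using that cancel[of k] by (simp add: z'_def pp_def u'_def v'_def smult_path_point[symmetric])
  have FT: "pp False l m k \<le> pp True l m k" if "normalized l m" for l m k
    unfolding pp_def using that sg vu by (intro path_point_False_le_True)
  \<comment> \<open>No path point lies strictly inside a jump: each is before its
    \<open>False\<close> end or after its \<open>True\<close> end.\<close>
  have adj: "(\<forall>k. pp b l m k \<le> pp False l' m' k) \<or> (\<forall>k. pp True l' m' k \<le> pp b l m k)"
    if n: "normalized l m" "normalized l' m'" for b l m l' m'
  proof (cases "(l, m) = (l', m')")
    case True
    then show ?thesis using refl by (cases b) auto
  next
    case False
    then show ?thesis using normalized_linear[OF n] n sg vu
      unfolding pp_def by (metis path_point_mono)
  qed
  have chain: "(\<forall>k. pp b l m k \<le> pp b' l' m' k) \<or> (\<forall>k. pp b' l' m' k \<le> pp b l m k)"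
    if n: "normalized l m" "normalized l' m'" for b l m b' l' m'
  proof (cases "(l, m) = (l', m')")
    case True
    then show ?thesis using refl FT[OF n(1)] by (cases b; cases b') auto
  next
    case False
    then show ?thesis using normalized_linear[OF n] n sg vu
      unfolding pp_def by (metis path_point_mono)
  qed
  \<comment> \<open>The \<open>F k\<close> are up-sets and the \<open>D k\<close> down-sets of a chain, so finitely many of them have a
    common point as soon as any two of them meet.\<close>
  define F where "F k = {(b, l, m). normalized l m \<and> z' k \<le> pp b l m k}" for k
  define D where "D k = {(b, l, m). normalized l m \<and> pp b l m k \<le> z' k}" for k
  have pair: "\<exists>b l m. (b, l, m) \<in> F j \<inter> D k" if "j \<noteq> k" for j k
  proof -
    have "\<not> separated (u' j) (u' k) (v' j) (v' k) (z' j) (z' k)"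
      using half[OF that] unfolding separated_def by blast
    then show ?thesis
      using path_point_meets_pair[of "u' j" "v' j" "z' j" "u' k" "v' k" "z' k"] sg vz zu
      unfolding F_def D_def pp_def by auto
  qed
  have "F j \<subseteq> F j' \<or> F j' \<subseteq> F j" for j j'
  proof (rule ccontr)
    assume "\<not> ?thesis"
    then obtain b l m b' l' m' where "(b, l, m) \<in> F j" "(b, l, m) \<notin> F j'" "(b', l', m') \<in> F j'" "(b', l', m') \<notin> F j"
      by (metis prod_cases3 subsetI)
    then have *: "normalized l m" "normalized l' m'" "z' j \<le> pp b l m j" "\<not> z' j \<le> pp b' l' m' j"
      "z' j' \<le> pp b' l' m' j'" "\<not> z' j' \<le> pp b l m j'" by (auto simp: F_def)
    then show False using chain[OF *(1,2), of b b'] trans[OF sg(3) pps pps] by blast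
  qed
  from finite_chain_least[of F, OF this] obtain j where j: "\<And>i. F j \<subseteq> F i" by blast
  have "D j \<subseteq> D j' \<or> D j' \<subseteq> D j" for j j'
  proof (rule ccontr)
    assume "\<not> ?thesis"
    then obtain b l m b' l' m' where "(b, l, m) \<in> D j" "(b, l, m) \<notin> D j'" "(b', l', m') \<in> D j'" "(b', l', m') \<notin> D j"
      by (metis prod_cases3 subsetI)
    then have *: "normalized l m" "normalized l' m'" "pp b l m j \<le> z' j" "\<not> pp b' l' m' j \<le> z' j"
      "pp b' l' m' j' \<le> z' j'" "\<not> pp b l m j' \<le> z' j'" by (auto simp: D_def)
    then show False using chain[OF *(1,2), of b b'] trans[OF pps pps sg(3)] by blast
  qed
  from finite_chain_least[of D, OF this] obtain k where k: "\<And>i. D k \<subseteq> D i" by blast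
  show thesis
  proof (cases "F j \<inter> D k = {}")
    case False
    then obtain b l m where blm: "(b, l, m) \<in> F j" "(b, l, m) \<in> D k" by auto
    have n: "normalized l m" using blm by (simp add: F_def)
    have "z' i = pp b l m i" for i
    proof (rule signed_le_antisym[OF sg(3) pps[OF n]])
      show "z' i \<le> pp b l m i" using j[of i] blm(1) by (auto simp: F_def)
      show "pp b l m i \<le> z' i" using k[of i] blm(2) by (auto simp: D_def)
    qed
    then have "z $ i = path_point b l m (u $ i) (v $ i)" for i using pp_eq by blast
    then show thesis using that(1) n by blast
  next
    case empty: True
    then have jk: "j = k" using pair by blast
    have "\<not> (\<exists>b l m. normalized l m \<and> path_point b l m (u' k) (v' k) = z' k)"
    proof
      assume "\<exists>b l m. normalized l m \<and> path_point b l m (u' k) (v' k) = z' k"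
      then obtain b l m where "normalized l m" "path_point b l m (u' k) (v' k) = z' k" by blast
      then have "(b, l, m) \<in> F k \<inter> D k" by (simp add: F_def D_def pp_def refl)
      then show False using empty jk by blast
    qed
    then obtain l m where lm: "normalized l m" "l * u' k = - (m * v' k)" "nrm (z' k) \<le> nrm (l * u' k)"
      "pp False l m k \<le> z' k" "z' k \<le> pp True l m k"
      using path_point_jump[OF sg(1) sg(2) sg(3) vz zu, of k] unfolding pp_def by blast
    have eq: "z' i = pp b l m i" if ik: "i \<noteq> k" for b i
    proof -
      \<comment> \<open>A path point in \<open>F i\<close> and \<open>D k\<close> cannot lie after
        the jump, since it would then belong to \<open>F k\<close> as well; so it lies before the
        jump and bounds \<open>z' i\<close> there.\<close>
      have lo: "z' i \<le> pp False l m i"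
      proof -
        obtain b1 l1 m1 where t: "(b1, l1, m1) \<in> F i" "(b1, l1, m1) \<in> D k" using pair[OF ik] by blast
        then have n1: "normalized l1 m1" by (simp add: F_def)
        have "\<not> (\<forall>k. pp True l m k \<le> pp b1 l1 m1 k)"
        proof
          assume "\<forall>k. pp True l m k \<le> pp b1 l1 m1 k"
          then have "z' k \<le> pp b1 l1 m1 k" using lm(1,5) trans[OF sg(3) pps pps] n1 by blast
          then have "(b1, l1, m1) \<in> F k" using n1 by (simp add: F_def)
          then show False using t empty jk by blast
        qed
        then have "pp b1 l1 m1 i \<le> pp False l m i" using adj[OF n1 lm(1)] by blast
        moreover have "z' i \<le> pp b1 l1 m1 i" using t by (simp add: F_def)
        ultimately show ?thesis using trans[OF sg(3) pps pps] n1 lm(1) by blast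
      qed
      have hi: "pp True l m i \<le> z' i"
      proof -
        obtain b1 l1 m1 where t: "(b1, l1, m1) \<in> F k" "(b1, l1, m1) \<in> D i" using pair[OF not_sym[OF ik]] by blast
        then have n1: "normalized l1 m1" by (simp add: F_def)
        have "\<not> (\<forall>k. pp b1 l1 m1 k \<le> pp False l m k)"
        proof
          assume "\<forall>k. pp b1 l1 m1 k \<le> pp False l m k"
          then have "pp b1 l1 m1 k \<le> z' k" using lm(1,4) trans[OF pps pps sg(3)] n1 by blast
          then have "(b1, l1, m1) \<in> D k" using n1 by (simp add: D_def)
          then show False using t empty jk by blast
        qed
        then have "pp True l m i \<le> pp b1 l1 m1 i" using adj[OF n1 lm(1)] by blast
        moreover have "pp b1 l1 m1 i \<le> z' i" using t by (simp add: D_def)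
        ultimately show ?thesis using trans[OF pps pps sg(3)] n1 lm(1) by blast
      qed
      have "z' i \<le> pp b l m i"
        using lo trans[OF sg(3) pps pps lo FT] lm(1) by (cases b) simp_all
      moreover have "pp b l m i \<le> z' i"
        using hi trans[OF pps pps sg(3) FT hi] lm(1) by (cases b) simp_all
      ultimately show ?thesis by (rule signed_le_antisym[OF sg(3) pps[OF lm(1)]])
    qed
    have "s k * (l * u $ k) = s k * - (m * v $ k)"
      using lm(2) unfolding u'_def v'_def uminus_mult_symtrop by (simp add: mult.left_commute)
    then have "l * u $ k = - (m * v $ k)" by (rule cancel)
    moreover have "nrm (z $ k) \<le> nrm (l * u $ k)" using lm(3) s by (simp add: z'_def u'_def)
    ultimately show thesis using that(2)[OF lm(1)] pp_eq[OF eq] by blast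
  qed
qed

section \<open>The TC-convex hull\<close>


text \<open>One of \<open>l\<close> and \<open>m\<close> is \<open>1\<close>, so a point with
  coefficient \<open>1\<close> in the corresponding combination keeps it.\<close>

lemma comb_left_sum:
  assumes u: "comb X lu" and v: "comb X lv" and n: "normalized l m"
  shows "comb X (\<lambda>x. l * lu x + m * lv x)"
  unfolding comb_iff
proof (intro conjI ballI)
  have nn: "l \<in> T_nonneg" "m \<in> T_nonneg" and mx: "max (nrm l) (nrm m) = 1"
    using n nrm_plus[of l m] by (auto simp: normalized_def)
  have L: "l * lu x + m * lv x \<in> T_nonneg" if "x \<in> X" for x
    using u v that nn by (auto simp: comb_def)
  then show "(\<lambda>x. l * lu x + m * lv x) \<in> X \<rightarrow> T_nonneg" by blast
  have "tsupp X (\<lambda>x. l * lu x + m * lv x) \<subseteq> tsupp X lu \<union> tsupp X lv" by (auto simp: tsupp_def)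
  then show "finite (tsupp X (\<lambda>x. l * lu x + m * lv x))"
    using u v by (auto simp: comb_def intro: finite_subset)
  show le: "nrm (l * lu x + m * lv x) \<le> 1" if "x \<in> X" for x
  proof -
    have "nrm (lu x) \<le> 1" "nrm (lv x) \<le> 1" using u v that by (auto simp: comb_iff)
    moreover have "nrm l \<le> 1" "nrm m \<le> 1" using mx by linarith+
    ultimately show ?thesis by (simp add: nrm_plus mult_le_one)
  qed
  have "\<exists>x\<in>X. 1 \<le> nrm (l * lu x + m * lv x)"
  proof (cases "nrm l = 1")
    case True
    obtain x where "x \<in> X" "lu x = 1" using u by (auto simp: comb_iff)
    then show ?thesis using True by (intro bexI[of _ x]) (simp_all add: nrm_plus)
  next
    case False
    then have "nrm m = 1" using mx by linarith
    moreover obtain x where "x \<in> X" "lv x = 1" using v by (auto simp: comb_iff)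
    ultimately show ?thesis by (intro bexI[of _ x]) (simp_all add: nrm_plus)
  qed
  then obtain x where x: "x \<in> X" "1 \<le> nrm (l * lu x + m * lv x)" by blast
  then have "l * lu x + m * lv x = 1" using le[of x] L[of x] by (intro nonneg_eqI) auto
  then show "\<exists>x\<in>X. l * lu x + m * lv x = 1" using x(1) by blast
qed

lemma TC_convex_filled:
  fixes X :: "(symtrop ^ 'n::finite) set"
  assumes X: "X \<subseteq> signed_vecs"
  shows "TC_convex {z. \<exists>l n. comb X l \<and> filled (tsupp X l) (\<lambda>x. l x *s x) z n}"
  unfolding TC_convex_def
proof (intro conjI ballI subsetI)
  fix z assume "z \<in> {z. \<exists>l n. comb X l \<and> filled (tsupp X l) (\<lambda>x. l x *s x) z n}"
  then show "z \<in> signed_vecs" by (auto simp: filled_def)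
next
  fix u v z
  assume "u \<in> {z. \<exists>l n. comb X l \<and> filled (tsupp X l) (\<lambda>x. l x *s x) z n}"
    and "v \<in> {z. \<exists>l n. comb X l \<and> filled (tsupp X l) (\<lambda>x. l x *s x) z n}"
    and z: "z \<in> conv_TC2 u v"
  then obtain lu nu lv nv where lu: "comb X lu" "filled (tsupp X lu) (\<lambda>x. lu x *s x) u nu"
    and lv: "comb X lv" "filled (tsupp X lv) (\<lambda>x. lv x *s x) v nv" by blast
  have us: "u \<in> signed_vecs" and vs: "v \<in> signed_vecs" using lu lv by (auto simp: filled_def)
  define L where "L l m x = l * lu x + m * lv x" for l m x
  define N where "N l m k = max (nrm l * nu k) (nrm m * nv k)" for l m k
  have f1: "filled (tsupp X (L l m)) (\<lambda>x. L l m x *s x) (left_sum_vec (l *s u) (m *s v)) (N l m)"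
    and f2: "filled (tsupp X (L l m)) (\<lambda>x. L l m x *s x) (left_sum_vec (m *s v) (l *s u)) (N l m)"
    if "normalized l m" for l m
  proof -
    \<comment> \<open>Coefficients and norms are symmetric although the left sum is not, so both
      orders give points of the same hypercube, as \<open>filled_edge\<close> requires.\<close>
    have L: "L l m = (\<lambda>x. l * lu x + m * lv x)" "L l m = (\<lambda>x. m * lv x + l * lu x)"
      by (auto simp: L_def add.commute)
    have N: "N l m = (\<lambda>k. max (nrm l * nu k) (nrm m * nv k))" "N l m = (\<lambda>k. max (nrm m * nv k) (nrm l * nu k))"
      by (auto simp: N_def max.commute)
    show "filled (tsupp X (L l m)) (\<lambda>x. L l m x *s x) (left_sum_vec (l *s u) (m *s v)) (N l m)"
      unfolding L(1) N(1) using X lu lv that by (intro filled_left_sum) (auto simp: comb_def normalized_def)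
    show "filled (tsupp X (L l m)) (\<lambda>x. L l m x *s x) (left_sum_vec (m *s v) (l *s u)) (N l m)"
      unfolding L(2) N(2) using X lu lv that by (intro filled_left_sum) (auto simp: comb_def normalized_def)
  qed
  have cL: "comb X (L l m)" if "normalized l m" for l m
    unfolding L_def using comb_left_sum[OF lu(1) lv(1) that] .
  from us vs z show "z \<in> {z. \<exists>l n. comb X l \<and> filled (tsupp X l) (\<lambda>x. l x *s x) z n}"
  proof (cases rule: conv_TC2_cases)
    case (1 b l m)
    then have "z = (if b then left_sum_vec (l *s u) (m *s v) else left_sum_vec (m *s v) (l *s u))"
      by (auto simp: vec_eq_iff path_point_def)
    then show ?thesis using f1[OF 1(1)] f2[OF 1(1)] cL[OF 1(1)] by (cases b) auto
  next
    case (2 a l m)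
    have eq: "nrm (l * u $ a) = nrm (m * v $ a)" unfolding 2(3) by (rule nrm_uminus)
    have "filled (tsupp X (L l m)) (\<lambda>x. L l m x *s x) z (N l m)"
    proof (rule filled_edge[OF f1[OF 2(1)] f2[OF 2(1)]])
      show "z \<in> signed_vecs" using z by (simp add: conv_TC2_def)
      show "z $ k = left_sum_vec (l *s u) (m *s v) $ k" if "k \<noteq> a" for k
        using 2(2)[OF that, of True] by (simp add: path_point_def)
      show "z $ k = left_sum_vec (m *s v) (l *s u) $ k" if "k \<noteq> a" for k
        using 2(2)[OF that, of False] by (simp add: path_point_def)
      show "left_sum_vec (l *s u) (m *s v) $ a = - left_sum_vec (m *s v) (l *s u) $ a"
        using 2(3) eq by (simp only: left_sum_vec_nth vector_smult_component left_sum_nrm) simp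
      show "nrm (z $ a) \<le> nrm (left_sum_vec (l *s u) (m *s v) $ a)"
        using 2(4) eq by (simp only: left_sum_vec_nth vector_smult_component left_sum_nrm) simp
    qed
    then show ?thesis using cL[OF 2(1)] by blast
  qed
qed

lemma point_filled:
  assumes "x \<in> X" "X \<subseteq> signed_vecs"
  shows "\<exists>l n. comb X l \<and> filled (tsupp X l) (\<lambda>x. l x *s x) x n"
proof (intro exI conjI)
  let ?l = "\<lambda>y. if y = x then 1 else 0 :: symtrop" let ?n = "\<lambda>k. nrm (x $ k)"
  have supp: "tsupp X ?l = {x}" using assms(1) by (auto simp: tsupp_def)
  show "comb X ?l" unfolding comb_iff supp using assms(1) by auto
  have "vert_by (\<lambda>_. 0) {x} (\<lambda>y. ?l y *s y) v" if "is_corner ?n x v" for v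
    using that by (simp add: is_corner_def vert_by_def)
  then show "filled (tsupp X ?l) (\<lambda>y. ?l y *s y) x ?n"
    unfolding filled_def supp using assms by blast
qed

theorem proposition3p24:
  fixes X :: "(symtrop ^ 'n::finite) set"
  assumes "X \<subseteq> signed_vecs"
  shows "conv_TC X =
    \<Union> {Faces_diag X l | l.
         l \<in> X \<rightarrow> T_nonneg \<and> finite (tsupp X l) \<and> (\<Sum>x\<in>tsupp X l. l x) = 1 \<and>
         card (tsupp X l) \<le> CARD('n) * 2 ^ CARD('n) + 1}" (is "_ = ?R")
proof
  let ?G = "{z. \<exists>l n. comb X l \<and> filled (tsupp X l) (\<lambda>x. l x *s x) z n}"
  have "conv_TC X \<subseteq> ?G"
    unfolding conv_TC_def using point_filled[OF _ assms] TC_convex_filled[OF assms]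
    by (intro hull_minimal) auto
  also have "?G \<subseteq> ?R"
  proof
    fix z assume "z \<in> ?G"
    then obtain l n where l: "comb X l" "card (tsupp X l) \<le> CARD('n) * 2 ^ CARD('n) + 1"
      "filled (tsupp X l) (\<lambda>x. l x *s x) z n"
      using caratheodory by blast
    then have "z \<in> Faces_diag X l"
      using tsupp_points_signed[OF assms] unfolding Faces_diag_def comb_def
      by (subst Faces_iff) auto
    then show "z \<in> ?R" using l unfolding comb_def by blast
  qed
  finally show "conv_TC X \<subseteq> ?R" .
  show "?R \<subseteq> conv_TC X"
  proof
    fix z assume "z \<in> ?R"
    then obtain l where "comb X l" "z \<in> Faces_diag X l" by (auto simp: comb_def)
    then show "z \<in> conv_TC X"
      unfolding conv_TC_def hull_def using Faces_diag_in_TC_convex by blast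
  qed
qed

end
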